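(* Let $N\to S$ be an extended Gibbons–Hawking hyperkähler space over an open subset $S\subset\mathbb{R}^m\otimes\mathbb{R}^3$, with Higgs field $(U_{IJ})$. The collective $\mathbb{H}^\times/\mathbb{Z}_2$-action on the base $S$ can be lifted to a hyperkähler cone structure on $N$ if and only if the Higgs field satisfies the linear differential constraints $$\vec L\,U_{IJ}=\vec 0\qquad\text{and}\qquad L_0\,U_{IJ}=-U_{IJ}\qquad\text{for all }I,J,$$ that is, if and only if it is invariant under rigid rotations and homogeneous of degree $-1$ in the variables $\vec x^{\,I}$. In this case the hyperkähler potential is given by $$U=2\,U_{IJ}\,\vec x^{\,I}\cdot\vec x^{\,J}.$$
   Context: **Extended Gibbons–Hawking space.** Indices $I,J,K$ run over a set of cardinality $m$; repeated indices are summed. $\mathbb{R}^m\otimes\mathbb{R}^3$ has coordinates $\vec x^{\,K}\in\mathbb{R}^3$, with $\vec\partial_K=\partial/\partial\vec x^{\,K}$. For $\mathbb{R}^3$-valued forms $(\vec a\wedge\vec b)_i=\varepsilon_{ijk}a_j\wedge b_k$. $N$ is a principal $\mathbb{R}^m$-bundle over $S$ with a principal connection of curvature $(F_K)$ and a symmetric matrix of functions $U_{IJ}$ on $S$ (the Higgs field) with $\det(U_{IJ})\ne0$, satisfying $$\vec\partial_IU_{KJ}=\vec\partial_JU_{KI},\qquad F_K=\star^I dU_{KI},$$ where $\star^I$ is linear over functions with $\star^Id\vec x^{\,J}=\frac12 d\vec x^{\,I}\wedge d\vec x^{\,J}$ (so $F_K=\frac12\vec\partial_JU_{KI}\cdot(d\vec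 x^{\,I}\wedge d\vec x^{\,J})$). In a local trivialization with fiber coordinates $\psi_K$ and local connection 1-forms $A_K$, $dA_K=F_K$, the hyperkähler structure on $N$ has symplectic forms $$\vec\Omega=-\tfrac12U_{IJ}\,d\vec x^{\,I}\wedge d\vec x^{\,J}-d\vec x^{\,K}\wedge(d\psi_K+A_K)$$ and metric $G=\frac12U_{IJ}d\vec x^{\,I}\cdot d\vec x^{\,J}+\frac12U^{IJ}(d\psi_I+A_I)(d\psi_J+A_J)$, with $U^{IJ}$ the inverse matrix (signature may be indefinite). **Collective action.** $\mathbb{H}^\times/\mathbb{Z}_2\cong\mathbb{R}^+\times SO(3)$ acts on $\mathbb{R}^m\otimes\mathbb{R}^3$ by rigid rotations and simultaneous scalings of the vectors $\vec x^{\,K}$, generated by $$\vec L=-\vec x^{\,K}\times\vec\partial_K,\qquad L_0=\vec x^{\,K}\cdot\vec\partial_K .$$ **Lifting to a hyperkähler cone structure.** This means: there exist vector fields $X_0,X_1,X_2,X_3$ on $N$ projecting to $L_0,L_1,L_2,L_3$ on $S$, and a function $U$ on $N$, such that $$\iota_{X_i}\Omega_j=\varepsilon_{ijk}\,\iota_{X_0}\Omega_k-\tfrac12\delta_{ij}\,dU\qquad\text{and}\qquad\mathcal{L}_{X_0}\Omega_k=\Omega_k\qquad(i,j,k\in\{1,2,3\}).$$ Here $U$ is the hyperkähler potential (determined by these conditions up to an additive constant), i.e. a function which is simultaneously a Kähler potential for each $\Omega_i$ with respect to its complex structure: $\Omega_i=\frac12d(dU\circ I_i)$. Equivalently $2X_0$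 is a homothetic Euler vector field, $\nabla_Y(2X_0)=Y$ for all $Y$. *)

theory Defs
  imports "HOL-Analysis.Analysis"
begin

section \<open>Calculus on open subsets of a normed space\<close>

primrec C_k_on :: "nat \<Rightarrow> 'a::real_normed_vector set \<Rightarrow> ('a \<Rightarrow> 'b::real_normed_vector) \<Rightarrow> bool" where
  "C_k_on 0 S f \<longleftrightarrow> continuous_on S f"
| "C_k_on (Suc k) S f \<longleftrightarrow>
     (\<forall>x\<in>S. f differentiable (at x)) \<and> (\<forall>v. C_k_on k S (\<lambda>x. frechet_derivative f (at x) v))"

text \<open>Only used on open sets, where \<open>at x\<close> and \<open>at x within S\<close> agree.\<close>

definition smooth_on :: "'a::real_normed_vector set \<Rightarrow> ('a \<Rightarrow> 'b::real_normed_vector) \<Rightarrow> bool" where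
  "smooth_on S f \<longleftrightarrow> (\<forall>k. C_k_on k S f)"

definition dir_deriv :: "('a::real_normed_vector \<Rightarrow> 'a) \<Rightarrow> ('a \<Rightarrow> 'b::real_normed_vector) \<Rightarrow> 'a \<Rightarrow> 'b" where
  "dir_deriv X f x = frechet_derivative f (at x) (X x)"

text \<open>Forms are functions of the base point followed by the tangent vectors. The conventions are
  \<open>(\<alpha> \<and> \<beta>)(v, w) = \<alpha>(v) \<beta>(w) - \<alpha>(w) \<beta>(v)\<close> and
  \<open>d\<alpha>(V, W) = V(\<alpha>(W)) - W(\<alpha>(V)) - \<alpha>([V, W])\<close>, evaluated on constant vector fields.\<close>

definition ext_deriv :: "('a::real_normed_vector \<Rightarrow> 'a \<Rightarrow> real) \<Rightarrow> 'a \<Rightarrow> 'a \<Rightarrow> 'a \<Rightarrow> real" where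
  "ext_deriv \<alpha> p v w =
     frechet_derivative (\<lambda>q. \<alpha> q w) (at p) v - frechet_derivative (\<lambda>q. \<alpha> q v) (at p) w"

text \<open>The coordinate formula
  \<open>(\<L>\<^sub>X\<omega>)(v, w) = (X\<cdot>\<omega>)(v, w) + \<omega>(\<partial>\<^sub>v X, w) + \<omega>(v, \<partial>\<^sub>w X)\<close>.\<close>

definition lie_deriv ::
  "('a::real_normed_vector \<Rightarrow> 'a) \<Rightarrow> ('a \<Rightarrow> 'a \<Rightarrow> 'a \<Rightarrow> real) \<Rightarrow> 'a \<Rightarrow> 'a \<Rightarrow> 'a \<Rightarrow> real" where
  "lie_deriv X \<omega> p v w =
     frechet_derivative (\<lambda>q. \<omega> q v w) (at p) (X p)
     + \<omega> p (frechet_derivative X (at p) v) w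
     + \<omega> p v (frechet_derivative X (at p) w)"


section \<open>The base space\<close>

text \<open>A point \<open>x\<close> of \<open>\<real>\<^sup>m \<otimes> \<real>\<^sup>3\<close> has \<open>m = CARD('m)\<close> components \<open>x $ K :: real^3\<close>.\<close>

type_synonym 'm base = "real^3^'m"

definition eps :: "3 \<Rightarrow> 3 \<Rightarrow> 3 \<Rightarrow> real" where
  "eps i j k = cross3 (axis i 1) (axis j 1) $ k"

text \<open>\<open>pd K i\<close> is the \<open>i\<close>-th component of \<open>\<partial>/\<partial>x\<^sup>K\<close>.\<close>

definition pd :: "'m \<Rightarrow> 3 \<Rightarrow> ('m::finite base \<Rightarrow> real) \<Rightarrow> 'm base \<Rightarrow> real" where
  "pd K i f x = frechet_derivative f (at x) (axis K (axis i 1))"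

text \<open>The \<open>i\<close>-th component of the \<open>\<real>\<^sup>3\<close>-valued 2-form \<open>dx\<^sup>I \<and> dx\<^sup>J\<close>, which is symmetric in \<open>I, J\<close>.\<close>

definition dx_wedge_dx :: "'m \<Rightarrow> 'm \<Rightarrow> 3 \<Rightarrow> 'm::finite base \<Rightarrow> 'm base \<Rightarrow> real" where
  "dx_wedge_dx I J i v w =
     (\<Sum>j\<in>UNIV. \<Sum>k\<in>UNIV. eps i j k * (v $ I $ j * w $ J $ k - w $ I $ j * v $ J $ k))"

text \<open>\<open>\<star>\<^sup>I\<close> at a point: \<open>\<alpha>\<close> is a covector, with coefficient \<open>\<alpha> (axis J (axis i 1))\<close> along \<open>dx\<^sup>J\<^sub>i\<close>.\<close>

definition star :: "'m \<Rightarrow> ('m::finite base \<Rightarrow> real) \<Rightarrow> 'm base \<Rightarrow> 'm base \<Rightarrow> real" where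
  "star I \<alpha> v w =
     (\<Sum>J\<in>UNIV. \<Sum>i\<in>UNIV. \<alpha> (axis J (axis i 1)) * (1/2 * dx_wedge_dx I J i v w))"

text \<open>The generators \<open>L\<^sub>0 = x\<^sup>K \<cdot> \<partial>\<^sub>K\<close> and \<open>L = - x\<^sup>K \<times> \<partial>\<^sub>K\<close> of the collective action; the
  \<open>\<partial>/\<partial>x\<^sup>K\<^sub>b\<close>-component of \<open>L\<^sub>i\<close> is \<open>- \<epsilon>\<^sub>i\<^sub>a\<^sub>b x\<^sup>K\<^sub>a\<close>.\<close>

definition L0 :: "'m::finite base \<Rightarrow> 'm base" where
  "L0 x = x"

definition L :: "3 \<Rightarrow> 'm::finite base \<Rightarrow> 'm base" where
  "L i x = (\<chi> K b. - (\<Sum>a\<in>UNIV. eps i a b * x $ K $ a))"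


section \<open>Extended Gibbons--Hawking spaces\<close>

text \<open>An \<open>\<real>\<^sup>m\<close>-bundle over \<open>base_set\<close> with total space \<open>total_space\<close> (a set in a topological space, with
  the subspace topology), a family of local trivializations \<open>u \<mapsto> (proj u, fibre a u)\<close> over
  \<open>patch a\<close>, the local connection forms \<open>conn a x v $ K = A\<^sub>K(v)\<close> on \<open>patch a\<close>, and the Higgs field
  \<open>higgs x $ I $ J = U\<^sub>I\<^sub>J(x)\<close>.\<close>

record ('n, 'c, 'm) gh_data =
  base_set :: "'m base set"
  total_space :: "'n set"
  proj :: "'n \<Rightarrow> 'm base"
  act :: "real^'m \<Rightarrow> 'n \<Rightarrow> 'n"
  patch :: "'c \<Rightarrow> 'm base set"
  fibre :: "'c \<Rightarrow> 'n \<Rightarrow> real^'m"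
  conn :: "'c \<Rightarrow> 'm base \<Rightarrow> 'm base \<Rightarrow> real^'m"
  higgs :: "'m base \<Rightarrow> real^'m^'m"

text \<open>Points of a chart, and also tangent vectors at them.\<close>

type_synonym 'm pt = "'m base \<times> (real^'m)"

definition over :: "('n, 'c, 'm::finite) gh_data \<Rightarrow> 'c \<Rightarrow> 'n set" where
  "over M a = {u \<in> total_space M. proj M u \<in> patch M a}"

definition chart :: "('n, 'c, 'm::finite) gh_data \<Rightarrow> 'c \<Rightarrow> 'n \<Rightarrow> 'm pt" where
  "chart M a u = (proj M u, fibre M a u)"

definition chart_inv :: "('n, 'c, 'm::finite) gh_data \<Rightarrow> 'c \<Rightarrow> 'm pt \<Rightarrow> 'n" where
  "chart_inv M a = inv_into (over M a) (chart M a)"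

definition chart_img :: "('n, 'c, 'm::finite) gh_data \<Rightarrow> 'c \<Rightarrow> 'm pt set" where
  "chart_img M a = patch M a \<times> UNIV"

definition trans_map :: "('n, 'c, 'm::finite) gh_data \<Rightarrow> 'c \<Rightarrow> 'c \<Rightarrow> 'm pt \<Rightarrow> 'm pt" where
  "trans_map M a b p = chart M b (chart_inv M a p)"

definition principal_bundle :: "('n::topological_space, 'c, 'm::finite) gh_data \<Rightarrow> bool" where
  "principal_bundle M \<longleftrightarrow>
     open (base_set M) \<and>
     continuous_on (total_space M) (proj M) \<and> proj M ` total_space M = base_set M \<and>
     (\<forall>a. open (patch M a)) \<and> (\<Union>a. patch M a) = base_set M \<and>
     (\<forall>t. \<forall>u\<in>total_space M. act M t u \<in> total_space M \<and> proj M (act M t u) = proj M u) \<and>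
     (\<forall>a. homeomorphism (over M a) (chart_img M a) (chart M a) (chart_inv M a)) \<and>
     (\<forall>a t. \<forall>u\<in>over M a. fibre M a (act M t u) = fibre M a u + t) \<and>
     (\<forall>a b. smooth_on (chart_img M a \<inter> chart_img M b) (trans_map M a b))"

text \<open>The forms \<open>\<eta>\<^sub>K = d\<psi>\<^sub>K + A\<^sub>K\<close> in the chart \<open>a\<close>. They define a principal connection iff they
  agree on overlaps.\<close>

definition eta :: "('n, 'c, 'm::finite) gh_data \<Rightarrow> 'c \<Rightarrow> 'm pt \<Rightarrow> 'm pt \<Rightarrow> real^'m" where
  "eta M a p v = snd v + conn M a (fst p) (fst v)"

definition principal_connection :: "('n, 'c, 'm::finite) gh_data \<Rightarrow> bool" where
  "principal_connection M \<longleftrightarrow>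
     (\<forall>a. \<forall>x\<in>patch M a. linear (conn M a x)) \<and>
     (\<forall>a v. smooth_on (patch M a) (\<lambda>x. conn M a x v)) \<and>
     (\<forall>a b. \<forall>p \<in> chart_img M a \<inter> chart_img M b. \<forall>v.
        eta M b (trans_map M a b p) (frechet_derivative (trans_map M a b) (at p) v) = eta M a p v)"

definition extended_gibbons_hawking :: "('n::topological_space, 'c, 'm::finite) gh_data \<Rightarrow> bool" where
  "extended_gibbons_hawking M \<longleftrightarrow>
     principal_bundle M \<and> principal_connection M \<and>
     smooth_on (base_set M) (higgs M) \<and>
     (\<forall>x\<in>base_set M. transpose (higgs M x) = higgs M x \<and> det (higgs M x) \<noteq> 0) \<and>
     (\<forall>x\<in>base_set M. \<forall>I J K i.
        pd I i (\<lambda>y. higgs M y $ K $ J) x = pd J i (\<lambda>y. higgs M y $ K $ I) x) \<and>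
     (\<forall>a. \<forall>x\<in>patch M a. \<forall>K v w.
        ext_deriv (\<lambda>y z. conn M a y z $ K) x v w =
        (\<Sum>I\<in>UNIV. star I (frechet_derivative (\<lambda>y. higgs M y $ K $ I) (at x)) v w))"

text \<open>The symplectic form \<open>\<Omega>\<^sub>i\<close> in the chart \<open>a\<close>.\<close>

definition Omega :: "('n, 'c, 'm::finite) gh_data \<Rightarrow> 'c \<Rightarrow> 3 \<Rightarrow> 'm pt \<Rightarrow> 'm pt \<Rightarrow> 'm pt \<Rightarrow> real" where
  "Omega M a i p v w =
     - (1/2) * (\<Sum>I\<in>UNIV. \<Sum>J\<in>UNIV. higgs M (fst p) $ I $ J * dx_wedge_dx I J i (fst v) (fst w))
     - (\<Sum>K\<in>UNIV. fst v $ K $ i * eta M a p w $ K - fst w $ K $ i * eta M a p v $ K)"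

text \<open>In \<open>G = \<onehalf> U\<^sub>I\<^sub>J dx\<^sup>I \<cdot> dx\<^sup>J + \<onehalf> U\<^sup>I\<^sup>J \<eta>\<^sub>I \<eta>\<^sub>J\<close> the symmetric product is read like the wedge product,
  \<open>\<alpha>\<beta> = \<alpha> \<otimes> \<beta> + \<beta> \<otimes> \<alpha>\<close>, which absorbs the factors \<open>\<onehalf>\<close>. This is the normalization for which \<open>G\<close>
  and the \<open>\<Omega>\<^sub>i\<close> are compatible (\<open>\<Omega>\<^sub>i = G(\<cdot>, I\<^sub>i \<cdot>)\<close> with \<open>I\<^sub>i\<^sup>2 = -1\<close>) and \<open>\<nabla>(2 X\<^sub>0) = id\<close> holds
  on a cone.\<close>

definition metric :: "('n, 'c, 'm::finite) gh_data \<Rightarrow> 'c \<Rightarrow> 'm pt \<Rightarrow> 'm pt \<Rightarrow> 'm pt \<Rightarrow> real" where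
  "metric M a p v w =
     (\<Sum>I\<in>UNIV. \<Sum>J\<in>UNIV. higgs M (fst p) $ I $ J * (fst v $ I \<bullet> fst w $ J))
     + (\<Sum>I\<in>UNIV. \<Sum>J\<in>UNIV. matrix_inv (higgs M (fst p)) $ I $ J * (eta M a p v $ I * eta M a p w $ J))"


section \<open>Functions and vector fields on the total space; cone structures\<close>

definition local_rep :: "('n, 'c, 'm::finite) gh_data \<Rightarrow> 'c \<Rightarrow> ('n \<Rightarrow> real) \<Rightarrow> 'm pt \<Rightarrow> real" where
  "local_rep M a f p = f (chart_inv M a p)"

definition smooth_fun :: "('n, 'c, 'm::finite) gh_data \<Rightarrow> ('n \<Rightarrow> real) \<Rightarrow> bool" where
  "smooth_fun M f \<longleftrightarrow> (\<forall>a. smooth_on (chart_img M a) (local_rep M a f))"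

text \<open>A vector field on the total space is given by its components in all charts.\<close>

definition vector_field :: "('n, 'c, 'm::finite) gh_data \<Rightarrow> ('c \<Rightarrow> 'm pt \<Rightarrow> 'm pt) \<Rightarrow> bool" where
  "vector_field M X \<longleftrightarrow>
     (\<forall>a. smooth_on (chart_img M a) (X a)) \<and>
     (\<forall>a b. \<forall>p \<in> chart_img M a \<inter> chart_img M b.
        X b (trans_map M a b p) = dir_deriv (X a) (trans_map M a b) p)"

definition projects_to ::
  "('n, 'c, 'm::finite) gh_data \<Rightarrow> ('c \<Rightarrow> 'm pt \<Rightarrow> 'm pt) \<Rightarrow> ('m base \<Rightarrow> 'm base) \<Rightarrow> bool" where
  "projects_to M X l \<longleftrightarrow> (\<forall>a. \<forall>p\<in>chart_img M a. fst (X a p) = l (fst p))"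

text \<open>\<open>X\<^sub>0\<close> and \<open>X 1, X 2, X 3\<close> lift the collective action to a hyperkaehler cone structure with
  hyperkaehler potential \<open>U\<close>.\<close>

definition cone_lift ::
  "('n, 'c, 'm::finite) gh_data \<Rightarrow> ('c \<Rightarrow> 'm pt \<Rightarrow> 'm pt) \<Rightarrow> (3 \<Rightarrow> 'c \<Rightarrow> 'm pt \<Rightarrow> 'm pt) \<Rightarrow>
   ('n \<Rightarrow> real) \<Rightarrow> bool" where
  "cone_lift M X0 X U \<longleftrightarrow>
     vector_field M X0 \<and> projects_to M X0 L0 \<and>
     (\<forall>i. vector_field M (X i) \<and> projects_to M (X i) (L i)) \<and>
     smooth_fun M U \<and>
     (\<forall>a. \<forall>p\<in>chart_img M a. \<forall>i j v.
        Omega M a j p (X i a p) v =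
        (\<Sum>k\<in>UNIV. eps i j k * Omega M a k p (X0 a p) v)
        - 1/2 * (if i = j then 1 else 0) * frechet_derivative (local_rep M a U) (at p) v) \<and>
     (\<forall>a. \<forall>p\<in>chart_img M a. \<forall>k v w. lie_deriv (X0 a) (Omega M a k) p v w = Omega M a k p v w)"

text \<open>A simultaneous Kaehler potential, \<open>\<Omega>\<^sub>i = \<onehalf> d(dU \<circ> I\<^sub>i)\<close>. The complex structures \<open>I\<^sub>i\<close> are determined
  by \<open>\<Omega>\<^sub>i(v, w) = G(v, I\<^sub>i w)\<close> since \<open>G\<close> is nondegenerate. With this sign a cone lift has
  \<open>X\<^sub>i = - I\<^sub>i X\<^sub>0\<close> and \<open>dU \<circ> I\<^sub>i = 2 \<iota>\<^sub>X\<^sub>0 \<Omega>\<^sub>i\<close>; the opposite one would replace \<open>U\<close> by \<open>- U\<close>.\<close>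

definition hyperkaehler_potential :: "('n, 'c, 'm::finite) gh_data \<Rightarrow> ('n \<Rightarrow> real) \<Rightarrow> bool" where
  "hyperkaehler_potential M U \<longleftrightarrow>
     smooth_fun M U \<and>
     (\<forall>a. \<exists>Ic :: 3 \<Rightarrow> 'm pt \<Rightarrow> 'm pt \<Rightarrow> 'm pt.
        \<forall>p\<in>chart_img M a. \<forall>i v w.
          Omega M a i p v w = metric M a p v (Ic i p w) \<and>
          Omega M a i p v w =
            1/2 * ext_deriv (\<lambda>q z. frechet_derivative (local_rep M a U) (at q) (Ic i q z)) p v w)"

end

theory Submission
  imports Defs
begin

text \<open>
  Write \<open>\<Omega>(v, w) = - U\<^sub>I\<^sub>J v\<^sup>I \<times> w\<^sup>J - v\<^sup>K \<eta>\<^sub>K(w) + w\<^sup>K \<eta>\<^sub>K(v)\<close>. Given the projections of the \<open>X\<^sub>i\<close>, comparing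
  coefficients in \<open>\<iota>\<^sub>X\<^sub>i \<Omega>\<^sub>j = \<epsilon>\<^sub>i\<^sub>j\<^sub>k \<iota>\<^sub>X\<^sub>0 \<Omega>\<^sub>k - \<onehalf> \<delta>\<^sub>i\<^sub>j dV\<close> shows that this equation is equivalent to
  \<open>\<eta>(X\<^sub>0) = 0\<close>, \<open>\<eta>\<^sub>K(X\<^sub>i) = - U\<^sub>I\<^sub>K x\<^sup>I\<^sub>i\<close> and \<open>dV = 2 U\<^sub>I\<^sub>J x\<^sup>I \<bullet> dx\<^sup>J\<close>. For the horizontal lift \<open>X\<^sub>0\<close>,
  the tensor \<open>\<L>\<^sub>X\<^sub>0 \<Omega> - \<Omega>\<close> has only a \<open>dx \<and> dx\<close> part, built from \<open>L\<^sub>0 U\<^sub>I\<^sub>J + U\<^sub>I\<^sub>J\<close> and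
  \<open>\<iota>\<^sub>X\<^sub>0 F\<^sub>K = dx\<^sup>J \<bullet> L U\<^sub>K\<^sub>J\<close>, and evaluating it on coordinate vectors isolates both constraints. Conversely,
  under the constraints the gradient of \<open>2 U\<^sub>I\<^sub>J x\<^sup>I \<bullet> x\<^sup>J\<close> is \<open>2 U\<^sub>I\<^sub>J x\<^sup>I \<bullet> dx\<^sup>J\<close> because \<open>\<partial>\<^sub>K U\<^sub>I\<^sub>J\<close> is
  totally symmetric. This also yields \<open>dU \<circ> I\<^sub>i = 2 \<iota>\<^sub>X\<^sub>0 \<Omega>\<^sub>i\<close>, whose exterior derivative is \<open>2 \<Omega>\<^sub>i\<close>.
\<close>

section \<open>Smooth functions on open sets\<close>

text \<open>\<open>frechet_derivative\<close> is a choice operator, so the two derivatives are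
  compared only where one function is differentiable. Openness of \<open>S\<close> makes agreement
  on \<open>S\<close> enough there.\<close>

lemma C_k_on_cong:
  assumes "open S" and "\<And>x. x \<in> S \<Longrightarrow> f x = g x"
  shows "C_k_on k S f \<longleftrightarrow> C_k_on k S g"
  using assms(2)
proof (induction k arbitrary: f g)
  case 0
  then show ?case by (auto intro: continuous_on_cong)
next
  case (Suc k)
  have fd: "frechet_derivative f (at x) = frechet_derivative g (at x)"
    if "x \<in> S" "f differentiable at x \<or> g differentiable at x" for x
    using that frechet_derivative_transform_within_open[OF _ \<open>open S\<close> that(1), of f g]
      frechet_derivative_transform_within_open[OF _ \<open>open S\<close> that(1), of g f] Suc.prems by metis
  have df: "f differentiable at x \<longleftrightarrow> g differentiable at x" if "x \<in> S" for x
    using that Suc.prems \<open>open S\<close> has_derivative_transform_within_open[of f _ x UNIV S g]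
      has_derivative_transform_within_open[of g _ x UNIV S f]
    unfolding differentiable_def by metis
  show ?case
    using Suc.IH[of "\<lambda>x. frechet_derivative f (at x) v" "\<lambda>x. frechet_derivative g (at x) v" for v]
      fd df by auto
qed

lemma C_k_on_Suc_imp: "C_k_on (Suc k) S f \<Longrightarrow> C_k_on k S f"
  by (induction k arbitrary: f)
    (auto simp: differentiable_imp_continuous_within continuous_at_imp_continuous_on)

text \<open>Trades the chosen \<open>frechet_derivative\<close> for an explicit \<open>D\<close>, so
  that closure under an operation becomes an induction on \<open>k\<close> using its differentiation
  rule.\<close>

lemma C_k_on_SucI:
  assumes "open S" and D: "\<And>x. x \<in> S \<Longrightarrow> (f has_derivative D x) (at x)"
    and "\<And>v. C_k_on k S (\<lambda>x. D x v)"
  shows "C_k_on (Suc k) S f"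
proof -
  have "C_k_on k S (\<lambda>x. frechet_derivative f (at x) v)" for v
    using C_k_on_cong[OF assms(1), of "\<lambda>x. frechet_derivative f (at x) v" "\<lambda>x. D x v" k]
      assms(3) frechet_derivative_at[OF D] by simp
  then show ?thesis using D by (auto simp: differentiable_def)
qed

lemma C_k_on_SucD:
  assumes "C_k_on (Suc k) S f"
  shows "\<And>x. x \<in> S \<Longrightarrow> (f has_derivative frechet_derivative f (at x)) (at x)"
    and "\<And>v. C_k_on k S (\<lambda>x. frechet_derivative f (at x) v)"
  using assms by (auto simp: frechet_derivative_works)

lemma C_k_on_subset: "C_k_on k S f \<Longrightarrow> T \<subseteq> S \<Longrightarrow> C_k_on k T f"
  by (induction k arbitrary: f) (auto intro: continuous_on_subset)

lemma C_k_on_const: "open S \<Longrightarrow> C_k_on k S (\<lambda>x. c)"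
  by (induction k arbitrary: c) (auto simp: frechet_derivative_const)

lemma C_k_on_bounded_linear:
  assumes "open S" "bounded_linear f"
  shows "C_k_on k S f"
proof (cases k)
  case 0
  then show ?thesis
    using assms(2) by (simp add: linear_continuous_on)
next
  case (Suc n)
  show ?thesis unfolding Suc
    by (rule C_k_on_SucI[OF assms(1) bounded_linear_imp_has_derivative[OF assms(2)]])
      (rule C_k_on_const[OF assms(1)])
qed

lemma C_k_on_compose_linear:
  assumes "open S" "bounded_linear h" "C_k_on k S f"
  shows "C_k_on k S (\<lambda>x. h (f x))"
  using assms(3)
proof (induction k arbitrary: f)
  case 0
  then show ?case
    using bounded_linear.continuous_on[OF assms(2)] by auto
next
  case (Suc k)
  note D = C_k_on_SucD[OF Suc.prems]
  show ?case
    by (rule C_k_on_SucI[OF assms(1) bounded_linear.has_derivative[OF assms(2) D(1)]])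
      (auto intro: Suc.IH D(2))
qed

lemma C_k_on_add:
  assumes "open S" "C_k_on k S f" "C_k_on k S g"
  shows "C_k_on k S (\<lambda>x. f x + g x)"
  using assms(2,3)
proof (induction k arbitrary: f g)
  case 0
  then show ?case by (auto intro: continuous_on_add)
next
  case (Suc k)
  note D = C_k_on_SucD[OF Suc.prems(1)] and E = C_k_on_SucD[OF Suc.prems(2)]
  show ?case
    by (rule C_k_on_SucI[OF assms(1) has_derivative_add[OF D(1) E(1)]])
      (auto intro: Suc.IH D(2) E(2))
qed

text \<open>Each term of the product rule pairs one function with a derivative of the other.
  \<open>C_k_on_Suc_imp\<close> lowers the undifferentiated factor to order \<open>k\<close>, so the
  induction hypothesis covers both terms.\<close>

lemma C_k_on_bilinear:
  assumes "open S" "bounded_bilinear b" "C_k_on k S f" "C_k_on k S g"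
  shows "C_k_on k S (\<lambda>x. b (f x) (g x))"
  using assms(3,4)
proof (induction k arbitrary: f g)
  case 0
  then show ?case
    using bounded_bilinear.continuous_on[OF assms(2)] by auto
next
  case (Suc k)
  note D = C_k_on_SucD[OF Suc.prems(1)] and E = C_k_on_SucD[OF Suc.prems(2)]
  show ?case
    by (rule C_k_on_SucI[OF assms(1) bounded_bilinear.FDERIV[OF assms(2) D(1) E(1)]])
      (auto intro!: C_k_on_add[OF assms(1)] Suc.IH D(2) E(2)
        C_k_on_Suc_imp[OF Suc.prems(1)] C_k_on_Suc_imp[OF Suc.prems(2)])
qed

text \<open>Moves smoothness from a patch to the chart image above it. Differentiating a pullback
  along \<open>fst\<close> gives a pullback again, which closes the induction.\<close>

lemma C_k_on_compose_fst:
  assumes "open S" "C_k_on k S f"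
  shows "C_k_on k (S \<times> UNIV) (\<lambda>p. f (fst p))"
  using assms(2)
proof (induction k arbitrary: f)
  case 0
  then show ?case
    by (auto intro!: continuous_on_compose2[of S f] continuous_intros)
next
  case (Suc k)
  note D = C_k_on_SucD[OF Suc.prems]
  have "((\<lambda>p. f (fst p)) has_derivative (\<lambda>h. frechet_derivative f (at (fst p)) (fst h))) (at p)"
    if "p \<in> S \<times> UNIV" for p :: "'a \<times> 'c"
    using has_derivative_compose[OF bounded_linear_imp_has_derivative[OF bounded_linear_fst] D(1)] that
    by auto
  then show ?case
    by (rule C_k_on_SucI[OF open_Times[OF assms(1) open_UNIV]]) (auto intro: Suc.IH D(2))
qed

lemma smooth_on_cong:
  assumes "open S" and "\<And>x. x \<in> S \<Longrightarrow> f x = g x"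
  shows "smooth_on S f \<longleftrightarrow> smooth_on S g"
  using C_k_on_cong[OF assms] by (simp add: smooth_on_def)

lemma smooth_on_subset: "smooth_on S f \<Longrightarrow> T \<subseteq> S \<Longrightarrow> smooth_on T f"
  unfolding smooth_on_def using C_k_on_subset by blast

lemma smooth_on_const: "open S \<Longrightarrow> smooth_on S (\<lambda>x. c)"
  by (simp add: smooth_on_def C_k_on_const)

lemma smooth_on_bounded_linear: "open S \<Longrightarrow> bounded_linear f \<Longrightarrow> smooth_on S f"
  by (simp add: smooth_on_def C_k_on_bounded_linear)

lemma smooth_on_compose_linear:
  "open S \<Longrightarrow> bounded_linear h \<Longrightarrow> smooth_on S f \<Longrightarrow> smooth_on S (\<lambda>x. h (f x))"
  by (simp add: smooth_on_def C_k_on_compose_linear)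

lemma smooth_on_add:
  "open S \<Longrightarrow> smooth_on S f \<Longrightarrow> smooth_on S g \<Longrightarrow> smooth_on S (\<lambda>x. f x + g x)"
  by (simp add: smooth_on_def C_k_on_add)

lemma smooth_on_minus: "open S \<Longrightarrow> smooth_on S f \<Longrightarrow> smooth_on S (\<lambda>x. - f x)"
  using smooth_on_compose_linear[OF _ bounded_linear_minus[OF bounded_linear_ident]] .

lemma smooth_on_diff:
  "open S \<Longrightarrow> smooth_on S f \<Longrightarrow> smooth_on S g \<Longrightarrow> smooth_on S (\<lambda>x. f x - g x)"
  using smooth_on_add[of S f "\<lambda>x. - g x"] smooth_on_minus[of S g] by simp

lemma smooth_on_bilinear:
  "open S \<Longrightarrow> bounded_bilinear b \<Longrightarrow> smooth_on S f \<Longrightarrow> smooth_on S g \<Longrightarrow>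
    smooth_on S (\<lambda>x. b (f x) (g x))"
  by (simp add: smooth_on_def C_k_on_bilinear)

lemma smooth_on_sum:
  assumes "open S" "\<And>i. i \<in> A \<Longrightarrow> smooth_on S (f i)"
  shows "smooth_on S (\<lambda>x. \<Sum>i\<in>A. f i x)"
  using assms(2)
  by (induction A rule: infinite_finite_induct)
    (auto intro: smooth_on_const smooth_on_add assms(1))

lemma smooth_on_compose_fst:
  "open S \<Longrightarrow> smooth_on S f \<Longrightarrow> smooth_on (S \<times> UNIV) (\<lambda>p. f (fst p))"
  by (simp add: smooth_on_def C_k_on_compose_fst)

lemma smooth_on_Pair:
  assumes "open S" "smooth_on S f" "smooth_on S g"
  shows "smooth_on S (\<lambda>x. (f x, g x))"
proof -
  have "bounded_linear (\<lambda>u. (u, 0))" "bounded_linear (\<lambda>u. (0, u))"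
    by (intro bounded_linear_Pair bounded_linear_ident bounded_linear_zero)+
  from smooth_on_add[OF assms(1) smooth_on_compose_linear[OF assms(1) this(1) assms(2)]
      smooth_on_compose_linear[OF assms(1) this(2) assms(3)]]
  show ?thesis by simp
qed

lemma smooth_on_vec_lambda:
  fixes f :: "'a::real_normed_vector \<Rightarrow> 'i::finite \<Rightarrow> real"
  assumes "open S" "\<And>i. smooth_on S (\<lambda>x. f x i)"
  shows "smooth_on S (\<lambda>x. \<chi> i. f x i)"
proof -
  have "smooth_on S (\<lambda>x. \<Sum>i\<in>UNIV. f x i *\<^sub>R axis i (1::real))"
    by (intro smooth_on_sum assms smooth_on_bilinear[OF _ bounded_bilinear_scaleR] smooth_on_const)
  moreover have "(\<Sum>i\<in>UNIV. f x i *\<^sub>R axis i (1::real)) = (\<chi> i. f x i)" for x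
    by (simp add: vec_eq_iff axis_def if_distrib sum.delta cong: if_cong)
  ultimately show ?thesis by simp
qed

lemma smooth_on_has_derivative:
  assumes "smooth_on S f" "x \<in> S"
  shows "(f has_derivative frechet_derivative f (at x)) (at x)"
  using assms C_k_on_SucD(1) unfolding smooth_on_def by blast

section \<open>Algebra of the symplectic forms\<close>

lemma cross3_nth:
  "cross3 a b $ 1 = a $ 2 * b $ 3 - a $ 3 * b $ 2"
  "cross3 a b $ 2 = a $ 3 * b $ 1 - a $ 1 * b $ 3"
  "cross3 a b $ 3 = a $ 1 * b $ 2 - a $ 2 * b $ 1"
  by (simp_all add: cross3_def)

lemma inner_3: "a \<bullet> b = a $ 1 * b $ 1 + a $ 2 * b $ 2 + a $ 3 * b $ 3" for a b :: "real^3"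
  by (simp add: inner_vec_def sum_3)

lemma eps_simps [simp]:
  "eps 1 1 k = 0" "eps 2 2 k = 0" "eps 3 3 k = 0"
  "eps 1 2 k = (if k = 3 then 1 else 0)" "eps 2 1 k = (if k = 3 then -1 else 0)"
  "eps 2 3 k = (if k = 1 then 1 else 0)" "eps 3 2 k = (if k = 1 then -1 else 0)"
  "eps 3 1 k = (if k = 2 then 1 else 0)" "eps 1 3 k = (if k = 2 then -1 else 0)"
  using exhaust_3[of k] by (auto simp: eps_def cross3_nth axis_def)

text \<open>Antisymmetry of the cross product absorbs the minus sign of the wedge. Vector algebra
  then replaces the \<open>eps\<close> sums, and the symmetry in \<open>I\<close>, \<open>J\<close>
  is visible.\<close>

lemma dx_wedge_dx_eq:
  "dx_wedge_dx I J i v w = cross3 (v $ I) (w $ J) $ i + cross3 (v $ J) (w $ I) $ i"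
  using exhaust_3[of i]
  by (auto simp: dx_wedge_dx_def sum_3 cross3_nth algebra_simps)

lemma L_nth: "L i x $ K = cross3 (x $ K) (axis i 1)"
  using exhaust_3[of i]
  by (auto simp: L_def vec_eq_iff forall_3 sum_3 cross3_nth axis_def)

lemma sum_sum_symmetric:
  fixes S :: "real^'m^'m"
  assumes "transpose S = S"
  shows "(\<Sum>I\<in>UNIV. \<Sum>J\<in>UNIV. S $ I $ J * f J I) = (\<Sum>I\<in>UNIV. \<Sum>J\<in>UNIV. S $ I $ J * f I J)"
proof -
  have "S $ I $ J = S $ J $ I" for I J
    using assms by (metis transpose_def vec_lambda_beta)
  then show ?thesis
    by (subst sum.swap) simp
qed

text \<open>The three forms at one point, as an R^3-valued expression: \<open>v\<close>,
  \<open>w\<close> are base components and \<open>a\<close>, \<open>b\<close> the values of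
  \<open>eta\<close>, so no chart or connection appears. For symmetric \<open>S\<close> the factor
  1/2 in \<open>Omega\<close> cancels.\<close>

definition Omega_form :: "real^'m^'m \<Rightarrow> real^3^'m::finite \<Rightarrow> real^'m \<Rightarrow> real^3^'m \<Rightarrow> real^'m \<Rightarrow> real^3" where
  "Omega_form S v a w b =
     - (\<Sum>I\<in>UNIV. \<Sum>J\<in>UNIV. S $ I $ J *\<^sub>R cross3 (v $ I) (w $ J))
     - (\<Sum>K\<in>UNIV. b $ K *\<^sub>R v $ K) + (\<Sum>K\<in>UNIV. a $ K *\<^sub>R w $ K)"

lemma Omega_form_nth:
  "Omega_form S v a w b $ i =
     - (\<Sum>I\<in>UNIV. \<Sum>J\<in>UNIV. S $ I $ J * cross3 (v $ I) (w $ J) $ i)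
     - (\<Sum>K\<in>UNIV. b $ K * v $ K $ i) + (\<Sum>K\<in>UNIV. a $ K * w $ K $ i)"
  by (simp add: Omega_form_def)

lemma sum_dx_wedge_dx:
  assumes "transpose S = S"
  shows "(\<Sum>I\<in>UNIV. \<Sum>J\<in>UNIV. S $ I $ J * dx_wedge_dx I J i v w) =
    2 * (\<Sum>I\<in>UNIV. \<Sum>J\<in>UNIV. S $ I $ J * cross3 (v $ I) (w $ J) $ i)"
  using sum_sum_symmetric[OF assms, of "\<lambda>I J. cross3 (v $ I) (w $ J) $ i"]
  by (simp add: dx_wedge_dx_eq distrib_left sum.distrib)

lemma Omega_eq_form:
  assumes "transpose (higgs M (fst p)) = higgs M (fst p)"
  shows "Omega M a i p v w =
    Omega_form (higgs M (fst p)) (fst v) (eta M a p v) (fst w) (eta M a p w) $ i"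
  by (simp add: Omega_def Omega_form_nth sum_dx_wedge_dx[OF assms] sum_subtractf)
    (simp add: mult.commute)

text \<open>The 1-form U_IJ x^I . dx^J at \<open>x\<close>; twice this form turns out to be the
  differential of the potential.\<close>

definition theta :: "real^'m^'m \<Rightarrow> real^3^'m::finite \<Rightarrow> real^3^'m \<Rightarrow> real" where
  "theta S x v = (\<Sum>I\<in>UNIV. \<Sum>J\<in>UNIV. S $ I $ J * (x $ I \<bullet> v $ J))"

text \<open>Uses \<open>(x \<times> e\<^sub>i) \<times> v = e\<^sub>i (x \<bullet> v) - x v\<^sub>i\<close>.\<close>

lemma Omega_form_rotation:
  fixes S :: "real^'m::finite^'m"
  shows "Omega_form S (L i x) b v c $ j - (\<Sum>k\<in>UNIV. eps i j k * Omega_form S x a v c $ k) =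
     - (if i = j then theta S x v else 0)
     + (\<Sum>K\<in>UNIV. (b $ K + (\<Sum>I\<in>UNIV. S $ I $ K * x $ I $ i)) * v $ K $ j)
     - (\<Sum>K\<in>UNIV. a $ K * (\<Sum>k\<in>UNIV. eps i j k * v $ K $ k))"
proof -
  let ?f = "\<lambda>u. \<Sum>k\<in>UNIV. eps i j k * u $ k"
  have f: "linear ?f"
    by (rule linearI) (simp_all add: sum_3 algebra_simps)
  have A: "?f (Omega_form S x a v c) =
     - (\<Sum>I\<in>UNIV. \<Sum>J\<in>UNIV. S $ I $ J * ?f (cross3 (x $ I) (v $ J)))
     - (\<Sum>K\<in>UNIV. c $ K * ?f (x $ K)) + (\<Sum>K\<in>UNIV. a $ K * ?f (v $ K))"
    unfolding Omega_form_def linear_add[OF f] linear_diff[OF f] linear_neg[OF f] linear_sum[OF f]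
      linear_scale[OF f] by simp
  have B: "cross3 (cross3 y (axis i 1)) u $ j - (\<Sum>k\<in>UNIV. eps i j k * cross3 y u $ k) =
      (if i = j then y \<bullet> u else 0) - y $ i * u $ j" for y u :: "real^3"
    using exhaust_3[of i] exhaust_3[of j]
    by (auto simp: sum_3 cross3_nth axis_def inner_3)
  \<comment> \<open>\<open>B\<close> solved for the contracted term and scaled by a matrix entry, in
    the shape that rewrites under the double sum.\<close>
  have B': "S $ I $ J * (\<Sum>k\<in>UNIV. eps i j k * cross3 y u $ k) =
      S $ I $ J * cross3 (cross3 y (axis i 1)) u $ j
      - S $ I $ J * (if i = j then y \<bullet> u else 0) + S $ I $ J * y $ i * u $ j" for y u I J
  proof -
    have "?f (cross3 y u) = cross3 (cross3 y (axis i 1)) u $ j - (if i = j then y \<bullet> u else 0) + y $ i * u $ j"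
      using B[of y u] by linarith
    then show ?thesis by (simp only: right_diff_distrib distrib_left mult.assoc)
  qed
  have C: "cross3 y (axis i 1) $ j = (\<Sum>k\<in>UNIV. eps i j k * y $ k)" for y
    using exhaust_3[of i] exhaust_3[of j] by (auto simp: sum_3 cross3_nth axis_def)
  have D: "(\<Sum>K\<in>UNIV. (\<Sum>I\<in>UNIV. S $ I $ K * x $ I $ i) * v $ K $ j) =
      (\<Sum>I\<in>UNIV. \<Sum>J\<in>UNIV. S $ I $ J * x $ I $ i * v $ J $ j)"
    by (subst sum.swap) (simp add: sum_distrib_right)
  show ?thesis
    unfolding A B' unfolding Omega_form_nth L_nth C theta_def distrib_right sum.distrib D sum_subtractf
    by simp
qed

text \<open>For \<open>t = higgs_grad x K\<close> this is the curvature component F_K at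
  \<open>x\<close>, as \<open>conn_deriv_curv\<close> shows.\<close>

definition curv :: "('m \<Rightarrow> 'm \<Rightarrow> real^3) \<Rightarrow> 'm::finite base \<Rightarrow> 'm base \<Rightarrow> real" where
  "curv t v w = (\<Sum>I\<in>UNIV. \<Sum>J\<in>UNIV. t I J \<bullet> cross3 (v $ I) (w $ J))"

text \<open>Expanding the right side by p x (x x t) = (p . t) x - (p . x) t reduces the claim to
  det(x,v,w) t = (t . x) v x w + (t . v) w x x + (t . w) x x v, the expansion of \<open>t\<close> in
  the dual basis. The proof itself compares coordinates.\<close>

lemma cross3_identity:
  fixes t v w x :: "real^3"
  shows "(t \<bullet> v) *\<^sub>R cross3 x w - (t \<bullet> w) *\<^sub>R cross3 x v + (t \<bullet> cross3 v w) *\<^sub>R x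
     - (t \<bullet> x) *\<^sub>R cross3 v w = cross3 (cross3 v w) (cross3 x t)"
  by (simp add: vec_eq_iff forall_3 cross3_nth inner_3) (simp add: algebra_simps)

text \<open>Total symmetry of \<open>t\<close> allows all four sums to be relabelled so that
  \<open>t K I J\<close> meets v^I, w^J and x^K. Then \<open>cross3_identity\<close> applies
  termwise and \<open>rot\<close> removes its right side. This is the identity behind d(iota_X0
  Omega) = Omega.\<close>

lemma closedness_identity:
  fixes t :: "'m::finite \<Rightarrow> 'm \<Rightarrow> 'm \<Rightarrow> real^3"
  assumes sym: "\<And>I J K. t K I J = t I K J" "\<And>I J K. t K I J = t K J I"
    and rot: "\<And>I J. (\<Sum>K\<in>UNIV. cross3 (t K I J) (x $ K)) = 0"
  shows "(\<Sum>I\<in>UNIV. \<Sum>J\<in>UNIV. (\<Sum>K\<in>UNIV. t K I J \<bullet> v $ K) *\<^sub>R cross3 (x $ I) (w $ J))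
    - (\<Sum>I\<in>UNIV. \<Sum>J\<in>UNIV. (\<Sum>K\<in>UNIV. t K I J \<bullet> w $ K) *\<^sub>R cross3 (x $ I) (v $ J))
    + (\<Sum>K\<in>UNIV. curv (t K) v w *\<^sub>R x $ K)
    = (\<Sum>I\<in>UNIV. \<Sum>J\<in>UNIV. (\<Sum>K\<in>UNIV. t K I J \<bullet> x $ K) *\<^sub>R cross3 (v $ I) (w $ J))"
proof -
  have sym2: "t J K I = t K I J" for I J K
    using sym by metis
  have 1: "(\<Sum>I\<in>UNIV. \<Sum>J\<in>UNIV. (\<Sum>K\<in>UNIV. t K I J \<bullet> v $ K) *\<^sub>R cross3 (x $ I) (w $ J)) =
     (\<Sum>I\<in>UNIV. \<Sum>J\<in>UNIV. \<Sum>K\<in>UNIV. (t K I J \<bullet> v $ I) *\<^sub>R cross3 (x $ K) (w $ J))"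
  proof -
    have "(\<Sum>I\<in>UNIV. \<Sum>J\<in>UNIV. (\<Sum>K\<in>UNIV. t K I J \<bullet> v $ K) *\<^sub>R cross3 (x $ I) (w $ J)) =
      (\<Sum>J\<in>UNIV. \<Sum>I\<in>UNIV. \<Sum>K\<in>UNIV. (t K I J \<bullet> v $ K) *\<^sub>R cross3 (x $ I) (w $ J))"
      by (subst sum.swap) (simp only: scaleR_left.sum)
    also have "\<dots> = (\<Sum>J\<in>UNIV. \<Sum>K\<in>UNIV. \<Sum>I\<in>UNIV. (t I K J \<bullet> v $ K) *\<^sub>R cross3 (x $ I) (w $ J))"
      by (rule sum.cong[OF refl], subst sum.swap) (simp add: sym(1))
    also have "\<dots> = (\<Sum>I\<in>UNIV. \<Sum>J\<in>UNIV. \<Sum>K\<in>UNIV. (t K I J \<bullet> v $ I) *\<^sub>R cross3 (x $ K) (w $ J))"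
      by (rule sum.swap)
    finally show ?thesis .
  qed
  \<comment> \<open>Here the renaming of indices is cyclic rather than a transposition, which is
    what \<open>sym2\<close> is for.\<close>
  have 2: "(\<Sum>I\<in>UNIV. \<Sum>J\<in>UNIV. (\<Sum>K\<in>UNIV. t K I J \<bullet> w $ K) *\<^sub>R cross3 (x $ I) (v $ J)) =
     (\<Sum>I\<in>UNIV. \<Sum>J\<in>UNIV. \<Sum>K\<in>UNIV. (t K I J \<bullet> w $ J) *\<^sub>R cross3 (x $ K) (v $ I))"
  proof -
    have "(\<Sum>I\<in>UNIV. \<Sum>J\<in>UNIV. (\<Sum>K\<in>UNIV. t K I J \<bullet> w $ K) *\<^sub>R cross3 (x $ I) (v $ J)) =
      (\<Sum>J\<in>UNIV. \<Sum>I\<in>UNIV. \<Sum>K\<in>UNIV. (t K I J \<bullet> w $ K) *\<^sub>R cross3 (x $ I) (v $ J))"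
      by (subst sum.swap) (simp only: scaleR_left.sum)
    also have "\<dots> = (\<Sum>J\<in>UNIV. \<Sum>K\<in>UNIV. \<Sum>I\<in>UNIV. (t I J K \<bullet> w $ K) *\<^sub>R cross3 (x $ I) (v $ J))"
      by (rule sum.cong[OF refl], subst sum.swap) (simp add: sym2)
    finally show ?thesis .
  qed
  have 3: "(\<Sum>K\<in>UNIV. curv (t K) v w *\<^sub>R x $ K) =
     (\<Sum>I\<in>UNIV. \<Sum>J\<in>UNIV. \<Sum>K\<in>UNIV. (t K I J \<bullet> cross3 (v $ I) (w $ J)) *\<^sub>R x $ K)"
  proof -
    have "(\<Sum>K\<in>UNIV. curv (t K) v w *\<^sub>R x $ K) =
      (\<Sum>K\<in>UNIV. \<Sum>I\<in>UNIV. \<Sum>J\<in>UNIV. (t K I J \<bullet> cross3 (v $ I) (w $ J)) *\<^sub>R x $ K)"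
      by (simp only: curv_def scaleR_left.sum)
    also have "\<dots> = (\<Sum>I\<in>UNIV. \<Sum>K\<in>UNIV. \<Sum>J\<in>UNIV. (t K I J \<bullet> cross3 (v $ I) (w $ J)) *\<^sub>R x $ K)"
      by (rule sum.swap)
    also have "\<dots> = (\<Sum>I\<in>UNIV. \<Sum>J\<in>UNIV. \<Sum>K\<in>UNIV. (t K I J \<bullet> cross3 (v $ I) (w $ J)) *\<^sub>R x $ K)"
      by (rule sum.cong[OF refl]) (rule sum.swap)
    finally show ?thesis .
  qed
  \<comment> \<open>The right side of \<open>cross3_identity\<close> summed over \<open>K\<close>:
    linearity moves the sum inside, where it becomes minus the vanishing sum in
    \<open>rot\<close>.\<close>
  have 4: "(\<Sum>K\<in>UNIV. cross3 (cross3 (v $ I) (w $ J)) (cross3 (x $ K) (t K I J))) = 0" for I J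
  proof -
    let ?c = "cross3 (v $ I) (w $ J)"
    have "linear (\<lambda>u. cross3 ?c (- u))"
      by (rule linearI) (simp_all add: vec_eq_iff forall_3 cross3_nth algebra_simps)
    from linear_sum[OF this, of "\<lambda>K. cross3 (t K I J) (x $ K)" UNIV]
    have "cross3 ?c (- (\<Sum>K\<in>UNIV. cross3 (t K I J) (x $ K))) =
      (\<Sum>K\<in>UNIV. cross3 ?c (- cross3 (t K I J) (x $ K)))" .
    also have "\<dots> = (\<Sum>K\<in>UNIV. cross3 ?c (cross3 (x $ K) (t K I J)))"
      by (simp only: cross_skew[symmetric])
    finally have "(\<Sum>K\<in>UNIV. cross3 ?c (cross3 (x $ K) (t K I J))) =
      cross3 ?c (- (\<Sum>K\<in>UNIV. cross3 (t K I J) (x $ K)))" ..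
    then show ?thesis by (simp add: rot)
  qed
  have "(\<Sum>I\<in>UNIV. \<Sum>J\<in>UNIV. \<Sum>K\<in>UNIV. (t K I J \<bullet> v $ I) *\<^sub>R cross3 (x $ K) (w $ J)
      - (t K I J \<bullet> w $ J) *\<^sub>R cross3 (x $ K) (v $ I) + (t K I J \<bullet> cross3 (v $ I) (w $ J)) *\<^sub>R x $ K
      - (t K I J \<bullet> x $ K) *\<^sub>R cross3 (v $ I) (w $ J)) = 0"
    unfolding cross3_identity 4 by simp
  then show ?thesis
    unfolding 1 2 3 by (simp only: sum_subtractf sum.distrib scaleR_left.sum right_minus_eq)
qed

section \<open>Coordinate expansions, inverse matrices and local constancy\<close>

lemma linear_base_expand:
  fixes f :: "'m::finite base \<Rightarrow> real"
  assumes "linear f"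
  shows "f v = (\<Sum>K\<in>UNIV. (\<chi> a. f (axis K (axis a 1))) \<bullet> v $ K)"
proof -
  have "v = (\<Sum>K\<in>UNIV. \<Sum>a\<in>UNIV. v $ K $ a *\<^sub>R axis K (axis a 1))"
  proof (intro vec_eq_iff[THEN iffD2] allI)
    fix I b
    have "(\<Sum>a\<in>UNIV. v $ K $ a * axis K (axis a 1) $ I $ b) = (if K = I then v $ I $ b else 0)" for K
    proof (cases "K = I")
      case True
      have "(\<Sum>a\<in>UNIV. v $ K $ a * axis K (axis a 1) $ I $ b) = (\<Sum>a\<in>UNIV. if a = b then v $ I $ b else 0)"
        by (rule sum.cong) (auto simp: axis_def True)
      then show ?thesis using True by simp
    qed (simp add: axis_def)
    then show "v $ I $ b = (\<Sum>K\<in>UNIV. \<Sum>a\<in>UNIV. v $ K $ a *\<^sub>R axis K (axis a 1)) $ I $ b"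
      by simp
  qed
  then have "f v = f (\<Sum>K\<in>UNIV. \<Sum>a\<in>UNIV. v $ K $ a *\<^sub>R axis K (axis a 1))"
    by simp
  also have "\<dots> = (\<Sum>K\<in>UNIV. \<Sum>a\<in>UNIV. v $ K $ a * f (axis K (axis a 1)))"
    by (simp add: linear_sum[OF assms] linear_scale[OF assms])
  also have "\<dots> = (\<Sum>K\<in>UNIV. (\<chi> a. f (axis K (axis a 1))) \<bullet> v $ K)"
    by (simp add: inner_vec_def mult.commute)
  finally show ?thesis .
qed

lemma linear_Basis_expand:
  fixes f :: "'a::euclidean_space \<Rightarrow> 'b::real_vector"
  assumes "linear f"
  shows "f v = (\<Sum>b\<in>Basis. (v \<bullet> b) *\<^sub>R f b)"
proof -
  have "f v = f (\<Sum>b\<in>Basis. (v \<bullet> b) *\<^sub>R b)" by (simp add: euclidean_representation)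
  then show ?thesis by (simp add: linear_sum[OF assms] linear_scale[OF assms])
qed

text \<open>The device for reading off coefficients: on a coordinate vector every other summand is
  \<open>f I 0\<close>.\<close>

lemma sum_axis:
  fixes f :: "'i::finite \<Rightarrow> 'a::zero \<Rightarrow> 'b::comm_monoid_add"
  assumes "\<And>I. f I 0 = 0"
  shows "(\<Sum>I\<in>UNIV. f I (axis A \<alpha> $ I)) = f A \<alpha>"
proof -
  have "(\<Sum>I\<in>UNIV. f I (axis A \<alpha> $ I)) = (\<Sum>I\<in>UNIV. if I = A then f A \<alpha> else 0)"
    by (rule sum.cong) (auto simp: axis_def assms)
  then show ?thesis by simp
qed

lemma sum_axis_nth:
  fixes c :: "'i::finite \<Rightarrow> real"
  shows "(\<Sum>K\<in>UNIV. c K * axis A \<alpha> $ K $ j) = c A * \<alpha> $ j"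
  using sum_axis[of "\<lambda>K y. c K * y $ j" A \<alpha>] by simp

lemma ex_neq_3: "\<exists>i::3. i \<noteq> j"
  using exhaust_3[of j] by (metis zero_neq_one[where 'a=3] numeral_One)

lemma matrix_inv_vector:
  fixes A :: "real^'n::finite^'n"
  assumes "det A \<noteq> 0"
  shows "matrix_inv A *v (A *v y) = y" "A *v (matrix_inv A *v y) = y"
proof -
  have "invertible A" using assms by (simp add: invertible_det_nz)
  then have "A ** matrix_inv A = mat 1 \<and> matrix_inv A ** A = mat 1"
    unfolding invertible_def matrix_inv_def by (rule someI_ex)
  then show "matrix_inv A *v (A *v y) = y" "A *v (matrix_inv A *v y) = y"
    by (simp_all add: matrix_vector_mul_assoc)
qed

text \<open>Components need not be open, so constancy is local relative to \<open>S\<close>;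
  connectedness of the component makes it global there.\<close>

lemma locally_constant_on_component:
  assumes "C \<in> components S"
    and "\<And>u. u \<in> S \<Longrightarrow> \<exists>T. open T \<and> u \<in> T \<and> (\<forall>w\<in>S \<inter> T. f w = f u)"
  shows "\<exists>c. \<forall>u\<in>C. f u = c"
proof -
  have C: "connected C" "C \<subseteq> S"
    by (rule in_components_connected[OF assms(1)]) (rule in_components_subset[OF assms(1)])
  have "f u = f w" if "u \<in> C" "w \<in> C" for u w
  proof (rule connected_local_const[OF C(1) that], rule ballI)
    fix a assume "a \<in> C"
    then have "a \<in> S" using C(2) by blast
    from assms(2)[OF this] obtain T where "open T" "a \<in> T" "\<forall>w\<in>S \<inter> T. f w = f a"
      by blast
    then show "eventually (\<lambda>b. f a = f b) (at a within C)"
      unfolding eventually_at_topological using C(2) by (metis IntI subsetD)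
  qed
  then show ?thesis by blast
qed

section \<open>Extended Gibbons--Hawking spaces\<close>

locale extended_gh =
  fixes M :: "('n::topological_space, 'c, 'm::finite) gh_data"
  assumes gh: "extended_gibbons_hawking M"
begin

section \<open>The defining conditions separately, and changes of chart\<close>

lemma principal_bundle: "principal_bundle M"
  using gh unfolding extended_gibbons_hawking_def by blast

lemma principal_connection: "principal_connection M"
  using gh unfolding extended_gibbons_hawking_def by blast

lemma smooth_higgs: "smooth_on (base_set M) (higgs M)"
  using gh unfolding extended_gibbons_hawking_def by blast

lemma open_base: "open (base_set M)"
  using principal_bundle unfolding principal_bundle_def by blast

lemma cont_proj: "continuous_on (total_space M) (proj M)"
  using principal_bundle unfolding principal_bundle_def by blast

lemma proj_image: "proj M ` total_space M = base_set M"
  using principal_bundle unfolding principal_bundle_def by blast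

lemma patches: "(\<Union>a. patch M a) = base_set M"
  using principal_bundle unfolding principal_bundle_def by blast

lemma open_patch: "open (patch M a)"
  using principal_bundle unfolding principal_bundle_def by blast

lemma homeo: "homeomorphism (over M a) (chart_img M a) (chart M a) (chart_inv M a)"
  using principal_bundle unfolding principal_bundle_def by blast

lemma smooth_trans: "smooth_on (chart_img M a \<inter> chart_img M b) (trans_map M a b)"
  using principal_bundle unfolding principal_bundle_def by blast

lemma linear_conn: "x \<in> patch M a \<Longrightarrow> linear (conn M a x)"
  using principal_connection unfolding principal_connection_def by blast

lemma smooth_conn: "smooth_on (patch M a) (\<lambda>x. conn M a x v)"
  using principal_connection unfolding principal_connection_def by blast

lemma eta_trans: "p \<in> chart_img M a \<inter> chart_img M b \<Longrightarrow>
    eta M b (trans_map M a b p) (frechet_derivative (trans_map M a b) (at p) w) = eta M a p w"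
  using principal_connection unfolding principal_connection_def by blast

lemma higgs_transpose: "x \<in> base_set M \<Longrightarrow> transpose (higgs M x) = higgs M x"
  using gh unfolding extended_gibbons_hawking_def by blast

lemma higgs_det: "x \<in> base_set M \<Longrightarrow> det (higgs M x) \<noteq> 0"
  using gh unfolding extended_gibbons_hawking_def by blast

lemma higgs_pd: "x \<in> base_set M \<Longrightarrow>
    pd I i (\<lambda>y. higgs M y $ K $ J) x = pd J i (\<lambda>y. higgs M y $ K $ I) x"
  using gh unfolding extended_gibbons_hawking_def by blast

lemma curvature: "x \<in> patch M a \<Longrightarrow> ext_deriv (\<lambda>y z. conn M a y z $ K) x v w =
    (\<Sum>I\<in>UNIV. star I (frechet_derivative (\<lambda>y. higgs M y $ K $ I) (at x)) v w)"
  using gh unfolding extended_gibbons_hawking_def by blast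

lemma patch_subset: "patch M a \<subseteq> base_set M"
  using patches by auto

lemma patch_base: "x \<in> patch M a \<Longrightarrow> x \<in> base_set M"
  using patch_subset by auto

lemma higgs_sym: "x \<in> base_set M \<Longrightarrow> higgs M x $ I $ J = higgs M x $ J $ I"
  using arg_cong[of _ _ "\<lambda>A. A $ I $ J", OF higgs_transpose[of x]] by (simp add: transpose_def)

lemma open_chart_img: "open (chart_img M a)"
  unfolding chart_img_def by (intro open_Times open_patch open_UNIV)

lemma fst_chart_img: "p \<in> chart_img M a \<longleftrightarrow> fst p \<in> patch M a"
  by (cases p) (simp add: chart_img_def)

lemma chart_chart_inv: "p \<in> chart_img M a \<Longrightarrow> chart M a (chart_inv M a p) = p"
  by (rule homeomorphism_apply2[OF homeo])

lemma chart_inv_chart: "u \<in> over M a \<Longrightarrow> chart_inv M a (chart M a u) = u"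
  by (rule homeomorphism_apply1[OF homeo])

lemma proj_chart_inv: "p \<in> chart_img M a \<Longrightarrow> proj M (chart_inv M a p) = fst p"
  using chart_chart_inv[of p a] by (metis chart_def fst_conv)

lemma fst_trans_map: "p \<in> chart_img M a \<Longrightarrow> fst (trans_map M a b p) = fst p"
  by (simp add: trans_map_def chart_def proj_chart_inv)

text \<open>A change of trivialization covers the identity of the base, so its composition with
  \<open>fst\<close> is \<open>fst\<close> near \<open>p\<close>; uniqueness of the derivative does
  the rest.\<close>

lemma fst_deriv_trans_map:
  assumes "p \<in> chart_img M a \<inter> chart_img M b"
  shows "fst (frechet_derivative (trans_map M a b) (at p) v) = fst v"
proof -
  have "((\<lambda>q. fst (trans_map M a b q)) has_derivative
      (\<lambda>v. fst (frechet_derivative (trans_map M a b) (at p) v))) (at p)"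
    by (intro has_derivative_fst smooth_on_has_derivative[OF smooth_trans assms])
  moreover have "((\<lambda>q. fst (trans_map M a b q)) has_derivative fst) (at p)"
    by (rule has_derivative_transform_within_open[OF bounded_linear_imp_has_derivative[OF
            bounded_linear_fst] open_chart_img[of a]])
      (use assms in \<open>auto simp: fst_trans_map\<close>)
  ultimately show ?thesis by (rule fun_cong[OF has_derivative_unique])
qed

section \<open>Gradient of the Higgs field\<close>

definition higgs_grad :: "'m base \<Rightarrow> 'm \<Rightarrow> 'm \<Rightarrow> 'm \<Rightarrow> real^3" where
  "higgs_grad x K I J = (\<chi> a. pd K a (\<lambda>y. higgs M y $ I $ J) x)"

lemma higgs_has_derivative:
  assumes "x \<in> base_set M"
  shows "((\<lambda>y. higgs M y $ I $ J) has_derivative (\<lambda>v. \<Sum>K\<in>UNIV. higgs_grad x K I J \<bullet> v $ K)) (at x)"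
proof -
  let ?f = "\<lambda>y. higgs M y $ I $ J"
  have "bounded_linear (\<lambda>A::real^'m^'m. A $ I $ J)"
    by (rule bounded_linear_compose[OF bounded_linear_vec_nth bounded_linear_vec_nth])
  from bounded_linear.has_derivative[OF this smooth_on_has_derivative[OF smooth_higgs assms]]
  have *: "(?f has_derivative frechet_derivative ?f (at x)) (at x)"
    unfolding frechet_derivative_works[symmetric] by (rule differentiableI)
  have "frechet_derivative ?f (at x) = (\<lambda>v. \<Sum>K\<in>UNIV. higgs_grad x K I J \<bullet> v $ K)"
    unfolding higgs_grad_def pd_def
    by (rule ext, rule linear_base_expand, rule has_derivative_linear[OF *])
  with * show ?thesis by simp
qed

lemma higgs_frechet:
  "x \<in> base_set M \<Longrightarrow>
    frechet_derivative (\<lambda>y. higgs M y $ I $ J) (at x) v = (\<Sum>K\<in>UNIV. higgs_grad x K I J \<bullet> v $ K)"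
  by (rule fun_cong[OF frechet_derivative_at[OF higgs_has_derivative, symmetric]])

text \<open>The first identity differentiates the symmetry of the matrix, which holds on a
  neighbourhood. Combined with the integrability condition on \<open>pd\<close> it gives the second,
  and together they make the gradient totally symmetric.\<close>

lemma higgs_grad_sym:
  assumes "x \<in> base_set M"
  shows "higgs_grad x K I J = higgs_grad x K J I" "higgs_grad x K I J = higgs_grad x I K J"
proof -
  have *: "higgs_grad x K I J = higgs_grad x K J I" for K I J
  proof -
    have "((\<lambda>y. higgs M y $ J $ I) has_derivative (\<lambda>v. \<Sum>K\<in>UNIV. higgs_grad x K I J \<bullet> v $ K)) (at x)"
      by (rule has_derivative_transform_within_open[OF higgs_has_derivative[OF assms] open_base assms])
        (simp add: higgs_sym)
    from fun_cong[OF has_derivative_unique[OF this higgs_has_derivative[OF assms]]]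
    have eq: "(\<Sum>K\<in>UNIV. higgs_grad x K I J \<bullet> v $ K) = (\<Sum>K\<in>UNIV. higgs_grad x K J I \<bullet> v $ K)" for v .
    have sel: "(\<Sum>K'\<in>UNIV. g K' \<bullet> axis K (axis a 1) $ K') = g K $ a" for g :: "'m \<Rightarrow> real^3" and a
    proof -
      have "(\<Sum>K'\<in>UNIV. g K' \<bullet> axis K (axis a 1) $ K') =
          (\<Sum>K'\<in>UNIV. if K' = K then g K' \<bullet> axis a 1 else 0)"
        by (rule sum.cong) (auto simp: axis_def)
      then show ?thesis by (simp add: inner_axis)
    qed
    show ?thesis
      using eq[of "axis K (axis a 1)" for a] unfolding sel by (simp add: vec_eq_iff)
  qed
  show "higgs_grad x K I J = higgs_grad x K J I" by (rule *)
  have "higgs_grad x I K J = higgs_grad x J K I" for I J K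
    using higgs_pd[OF assms] by (simp add: higgs_grad_def)
  then show "higgs_grad x K I J = higgs_grad x I K J" using * by metis
qed

section \<open>Derivatives of the connection form and its curvature\<close>

definition conn_deriv :: "'c \<Rightarrow> 'm base \<Rightarrow> 'm base \<Rightarrow> 'm base \<Rightarrow> real^'m" where
  "conn_deriv a x h v = frechet_derivative (\<lambda>y. conn M a y v) (at x) h"

lemma conn_has_derivative:
  "x \<in> patch M a \<Longrightarrow> ((\<lambda>y. conn M a y v) has_derivative (\<lambda>h. conn_deriv a x h v)) (at x)"
  unfolding conn_deriv_def by (rule smooth_on_has_derivative[OF smooth_conn])

text \<open>Each wedge contributes two cross products with weight 1/2. By total symmetry of the
  gradient the two sums agree after exchanging \<open>I\<close> and \<open>J\<close>, so the halves
  add up to one \<open>curv\<close>.\<close>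

lemma conn_deriv_curv:
  assumes "x \<in> patch M a"
  shows "conn_deriv a x v w $ K - conn_deriv a x w v $ K = curv (higgs_grad x K) v w"
proof -
  note x = patch_base[OF assms]
  have "frechet_derivative (\<lambda>y. conn M a y v $ K) (at x) h = conn_deriv a x h v $ K" for v h
    using frechet_derivative_at[OF bounded_linear.has_derivative[OF bounded_linear_vec_nth
          conn_has_derivative[OF assms, of v]], THEN fun_cong, of h K] by simp
  then have "conn_deriv a x v w $ K - conn_deriv a x w v $ K = ext_deriv (\<lambda>y z. conn M a y z $ K) x v w"
    by (simp add: ext_deriv_def)
  also have "\<dots> = (\<Sum>I\<in>UNIV. \<Sum>J\<in>UNIV. \<Sum>i\<in>UNIV. higgs_grad x J K I $ i * (1/2 * dx_wedge_dx I J i v w))"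
    unfolding curvature[OF assms] star_def by (simp add: higgs_grad_def pd_def)
  also have "\<dots> = (\<Sum>I\<in>UNIV. \<Sum>J\<in>UNIV.
      1/2 * (higgs_grad x K I J \<bullet> cross3 (v $ I) (w $ J)) + 1/2 * (higgs_grad x K I J \<bullet> cross3 (v $ J) (w $ I)))"
  proof (intro sum.cong refl)
    fix I J
    have "higgs_grad x J K I = higgs_grad x K I J"
      using higgs_grad_sym[OF x] by metis
    then show "(\<Sum>i\<in>UNIV. higgs_grad x J K I $ i * (1/2 * dx_wedge_dx I J i v w)) =
      1/2 * (higgs_grad x K I J \<bullet> cross3 (v $ I) (w $ J)) + 1/2 * (higgs_grad x K I J \<bullet> cross3 (v $ J) (w $ I))"
      by (simp add: dx_wedge_dx_eq inner_3 sum_3 field_simps)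
  qed
  also have "\<dots> = 1/2 * curv (higgs_grad x K) v w + 1/2 * (\<Sum>I\<in>UNIV. \<Sum>J\<in>UNIV. higgs_grad x K I J \<bullet> cross3 (v $ J) (w $ I))"
    by (simp add: curv_def sum.distrib sum_distrib_left)
  also have "(\<Sum>I\<in>UNIV. \<Sum>J\<in>UNIV. higgs_grad x K I J \<bullet> cross3 (v $ J) (w $ I)) = curv (higgs_grad x K) v w"
    unfolding curv_def by (subst sum.swap) (simp add: higgs_grad_sym(1)[OF x, of K])
  finally show ?thesis by simp
qed

lemma conn_expand: "x \<in> patch M a \<Longrightarrow> conn M a x v = (\<Sum>b\<in>Basis. (v \<bullet> b) *\<^sub>R conn M a x b)"
  by (rule linear_Basis_expand[OF linear_conn])

text \<open>The point is both base point and argument, while smoothness is given for each fixed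
  argument only. Expanding the argument over \<open>Basis\<close> leaves a finite sum of
  products.\<close>

lemma conn_diagonal_has_derivative:
  assumes "x \<in> patch M a"
  shows "((\<lambda>y. conn M a y y) has_derivative (\<lambda>h. conn_deriv a x h x + conn M a x h)) (at x)"
proof -
  have D: "((\<lambda>y. \<Sum>b\<in>Basis. (g y \<bullet> b) *\<^sub>R conn M a y b) has_derivative
      (\<lambda>h. \<Sum>b\<in>Basis. (g x \<bullet> b) *\<^sub>R conn_deriv a x h b + (g' h \<bullet> b) *\<^sub>R conn M a x b)) (at x)"
    if "(g has_derivative g') (at x)" for g g'
    by (intro has_derivative_sum has_derivative_scaleR has_derivative_inner_left that
        conn_has_derivative[OF assms])
  \<comment> \<open>The same computation with a frozen argument: it yields the basis expansion of
    \<open>conn_deriv\<close> in its last slot.\<close>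
  have "((\<lambda>y. conn M a y x) has_derivative
      (\<lambda>h. \<Sum>b\<in>Basis. (x \<bullet> b) *\<^sub>R conn_deriv a x h b + (0 \<bullet> b) *\<^sub>R conn M a x b)) (at x)"
    by (rule has_derivative_transform_within_open[OF D[OF has_derivative_const] open_patch assms])
      (rule conn_expand[symmetric])
  from has_derivative_unique[OF this conn_has_derivative[OF assms]]
  have 1: "conn_deriv a x h x = (\<Sum>b\<in>Basis. (x \<bullet> b) *\<^sub>R conn_deriv a x h b)" for h
    by (simp add: fun_eq_iff)
  have "((\<lambda>y. conn M a y y) has_derivative
      (\<lambda>h. \<Sum>b\<in>Basis. (x \<bullet> b) *\<^sub>R conn_deriv a x h b + (h \<bullet> b) *\<^sub>R conn M a x b)) (at x)"
    by (rule has_derivative_transform_within_open[OF D[OF has_derivative_ident] open_patch assms])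
      (rule conn_expand[symmetric])
  then show ?thesis
    by (simp only: sum.distrib 1[symmetric] conn_expand[OF assms, symmetric])
qed

lemma smooth_conn_comp:
  assumes "smooth_on (patch M a) l"
  shows "smooth_on (patch M a) (\<lambda>x. conn M a x (l x))"
proof -
  have "smooth_on (patch M a) (\<lambda>x. \<Sum>b\<in>Basis. (l x \<bullet> b) *\<^sub>R conn M a x b)"
    by (intro smooth_on_sum open_patch smooth_on_bilinear[OF _ bounded_bilinear_scaleR]
        smooth_on_bilinear[OF _ bounded_bilinear_inner] assms smooth_on_const smooth_conn)
  moreover have "smooth_on (patch M a) (\<lambda>x. conn M a x (l x)) \<longleftrightarrow>
      smooth_on (patch M a) (\<lambda>x. \<Sum>b\<in>Basis. (l x \<bullet> b) *\<^sub>R conn M a x b)"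
    by (rule smooth_on_cong[OF open_patch]) (rule conn_expand)
  ultimately show ?thesis by blast
qed

section \<open>Vector fields lifted from the base\<close>

text \<open>Solving \<open>eta\<close> = \<xi> for the fibre component subtracts the connection
  term. For \<xi> = 0 this is the horizontal lift.\<close>

definition lift :: "('m base \<Rightarrow> 'm base) \<Rightarrow> ('m base \<Rightarrow> real^'m) \<Rightarrow> 'c \<Rightarrow> 'm pt \<Rightarrow> 'm pt" where
  "lift l \<xi> a p = (l (fst p), \<xi> (fst p) - conn M a (fst p) (l (fst p)))"

lemma fst_lift [simp]: "fst (lift l \<xi> a p) = l (fst p)"
  and eta_lift [simp]: "eta M a p (lift l \<xi> a p) = \<xi> (fst p)"
  by (simp_all add: lift_def eta_def)

lemma eq_by_eta: "fst v = fst w \<Longrightarrow> eta M a p v = eta M a p w \<Longrightarrow> v = w"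
  by (simp add: eta_def prod_eq_iff)

text \<open>A change of chart preserves both the base part and the value of \<open>eta\<close>.
  These determine a tangent vector by \<open>eq_by_eta\<close>, so the local expressions
  glue.\<close>

lemma vector_field_lift:
  assumes "smooth_on (base_set M) l" "smooth_on (base_set M) \<xi>"
  shows "vector_field M (lift l \<xi>)"
  unfolding vector_field_def
proof (intro conjI allI ballI)
  fix a
  note s = smooth_on_subset[OF _ patch_subset]
  have "smooth_on (patch M a) (\<lambda>x. (l x, \<xi> x - conn M a x (l x)))"
    by (intro smooth_on_Pair smooth_on_diff smooth_conn_comp open_patch s assms)
  from smooth_on_compose_fst[OF open_patch this]
  show "smooth_on (chart_img M a) (lift l \<xi> a)"
    by (simp add: lift_def[abs_def] chart_img_def)
next
  fix a b p assume p: "p \<in> chart_img M a \<inter> chart_img M b"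
  show "lift l \<xi> b (trans_map M a b p) = dir_deriv (lift l \<xi> a) (trans_map M a b) p"
    unfolding dir_deriv_def
  proof (rule eq_by_eta)
    show "fst (lift l \<xi> b (trans_map M a b p)) =
        fst (frechet_derivative (trans_map M a b) (at p) (lift l \<xi> a p))"
      using p by (simp add: fst_deriv_trans_map fst_trans_map)
    show "eta M b (trans_map M a b p) (lift l \<xi> b (trans_map M a b p)) =
        eta M b (trans_map M a b p) (frechet_derivative (trans_map M a b) (at p) (lift l \<xi> a p))"
      using p by (simp add: eta_trans fst_trans_map)
  qed
qed

section \<open>Derivatives of the Higgs field along the collective action\<close>

definition higgs_deriv :: "'m base \<Rightarrow> 'm base \<Rightarrow> 'm \<Rightarrow> 'm \<Rightarrow> real" where
  "higgs_deriv x v I J = (\<Sum>K\<in>UNIV. higgs_grad x K I J \<bullet> v $ K)"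

text \<open>The vector L U_IJ, as \<open>higgs_deriv_L\<close> confirms; the minus sign in L is
  absorbed by the order of the factors.\<close>

definition higgs_rot :: "'m base \<Rightarrow> 'm \<Rightarrow> 'm \<Rightarrow> real^3" where
  "higgs_rot x I J = (\<Sum>K\<in>UNIV. cross3 (higgs_grad x K I J) (x $ K))"

lemma has_derivative_higgs_deriv: 
  "x \<in> base_set M \<Longrightarrow> ((\<lambda>y. higgs M y $ I $ J) has_derivative (\<lambda>v. higgs_deriv x v I J)) (at x)"
  unfolding higgs_deriv_def by (rule higgs_has_derivative)

lemma higgs_deriv_sym: "x \<in> base_set M \<Longrightarrow> higgs_deriv x v I J = higgs_deriv x v J I"
  unfolding higgs_deriv_def using higgs_grad_sym(1) by simp

lemma dir_deriv_higgs:
  "x \<in> base_set M \<Longrightarrow> dir_deriv X (\<lambda>y. higgs M y $ I $ J) x = higgs_deriv x (X x) I J"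
  by (simp add: dir_deriv_def higgs_frechet higgs_deriv_def)

lemma higgs_deriv_L: "higgs_deriv x (L i x) I J = higgs_rot x I J $ i"
proof -
  have "t \<bullet> cross3 y (axis i 1) = cross3 t y $ i" for t y
    using exhaust_3[of i] by (auto simp: inner_3 cross3_nth axis_def)
  then show ?thesis by (simp add: higgs_deriv_def higgs_rot_def L_nth)
qed

text \<open>Contracting F_K with the Euler field: a cyclic permutation of the triple product and the
  symmetry of the gradient turn it into the rotational derivative of U_KJ.\<close>

lemma curv_euler:
  assumes "x \<in> base_set M"
  shows "curv (higgs_grad x K) x w = (\<Sum>J\<in>UNIV. w $ J \<bullet> higgs_rot x K J)"
proof -
  have "curv (higgs_grad x K) x w = (\<Sum>J\<in>UNIV. \<Sum>I\<in>UNIV. higgs_grad x K I J \<bullet> cross3 (x $ I) (w $ J))"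
    unfolding curv_def by (rule sum.swap)
  also have "\<dots> = (\<Sum>J\<in>UNIV. \<Sum>I\<in>UNIV. w $ J \<bullet> cross3 (higgs_grad x I K J) (x $ I))"
  proof (intro sum.cong refl)
    fix I J
    have "t \<bullet> cross3 y u = u \<bullet> cross3 t y" for t y u :: "real^3"
      by (simp add: inner_3 cross3_nth algebra_simps)
    then show "higgs_grad x K I J \<bullet> cross3 (x $ I) (w $ J) = w $ J \<bullet> cross3 (higgs_grad x I K J) (x $ I)"
      using higgs_grad_sym(2)[OF assms, of K I J] by simp
  qed
  finally show ?thesis by (simp add: higgs_rot_def inner_sum_right)
qed

section \<open>Lie derivative of the symplectic forms along the horizontal Euler lift\<close>

lemma Omega_form_eq:
  "p \<in> chart_img M a \<Longrightarrow> Omega M a i p v w =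
    Omega_form (higgs M (fst p)) (fst v) (eta M a p v) (fst w) (eta M a p w) $ i"
  by (rule Omega_eq_form[OF higgs_transpose[OF patch_base]]) (simp add: fst_chart_img)

lemma Omega_has_derivative:
  assumes p: "p \<in> chart_img M a"
  shows "((\<lambda>q. Omega M a k q v w) has_derivative (\<lambda>h.
      - (1/2) * (\<Sum>I\<in>UNIV. \<Sum>J\<in>UNIV. higgs_deriv (fst p) (fst h) I J * dx_wedge_dx I J k (fst v) (fst w))
      - (\<Sum>K\<in>UNIV. fst v $ K $ k * conn_deriv a (fst p) (fst h) (fst w) $ K
          - fst w $ K $ k * conn_deriv a (fst p) (fst h) (fst v) $ K))) (at p)"
proof -
  have x: "fst p \<in> patch M a" using p by (simp add: fst_chart_img)
  have F: "((\<lambda>q. fst q) has_derivative (\<lambda>h. fst h)) (at p)"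
    by (rule bounded_linear_imp_has_derivative[OF bounded_linear_fst])
  have U: "((\<lambda>q. higgs M (fst q) $ I $ J) has_derivative (\<lambda>h. higgs_deriv (fst p) (fst h) I J)) (at p)" for I J
    by (rule has_derivative_compose[OF F has_derivative_higgs_deriv[OF patch_base[OF x]]])
  have E': "((\<lambda>q. snd u + conn M a (fst q) (fst u)) has_derivative
      (\<lambda>h. 0 + conn_deriv a (fst p) (fst h) (fst u))) (at p)" for u
    by (intro has_derivative_add has_derivative_const has_derivative_compose[OF F conn_has_derivative[OF x]])
  have E: "((\<lambda>q. eta M a q u $ K) has_derivative (\<lambda>h. conn_deriv a (fst p) (fst h) (fst u) $ K)) (at p)" for u K
    using bounded_linear.has_derivative[OF bounded_linear_vec_nth E'[of u], of K] by (simp add: eta_def)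
  show ?thesis
    unfolding Omega_def
    by (intro has_derivative_diff has_derivative_sum has_derivative_mult_right has_derivative_mult_left U E)
qed

lemma lift_L0_has_derivative:
  assumes p: "p \<in> chart_img M a"
  shows "(lift L0 (\<lambda>_. 0) a has_derivative
    (\<lambda>h. (fst h, - (conn_deriv a (fst p) (fst h) (fst p) + conn M a (fst p) (fst h))))) (at p)"
proof -
  have x: "fst p \<in> patch M a" using p by (simp add: fst_chart_img)
  have F: "((\<lambda>q. fst q) has_derivative (\<lambda>h. fst h)) (at p)"
    by (rule bounded_linear_imp_has_derivative[OF bounded_linear_fst])
  have "((\<lambda>q. (fst q, - conn M a (fst q) (fst q))) has_derivative
      (\<lambda>h. (fst h, - (conn_deriv a (fst p) (fst h) (fst p) + conn M a (fst p) (fst h))))) (at p)"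
    by (intro has_derivative_Pair F has_derivative_minus
        has_derivative_compose[OF F conn_diagonal_has_derivative[OF x]])
  then show ?thesis by (simp add: lift_def[abs_def] L0_def)
qed

text \<open>The two terms with a differentiated vector field give twice the \<open>cross3\<close>
  part of Omega, so one copy is left over beside the derivative of the Higgs field. All derivatives
  of the connection combine into curvature.\<close>

lemma lie_deriv_lift_L0:
  assumes p: "p \<in> chart_img M a"
  defines "x \<equiv> fst p"
  shows "lie_deriv (lift L0 (\<lambda>_. 0) a) (Omega M a k) p v w = Omega M a k p v w
    - (\<Sum>I\<in>UNIV. \<Sum>J\<in>UNIV. (higgs_deriv x x I J + higgs M x $ I $ J) * cross3 (fst v $ I) (fst w $ J) $ k)
    - (\<Sum>K\<in>UNIV. fst v $ K $ k * curv (higgs_grad x K) x (fst w))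
    + (\<Sum>K\<in>UNIV. fst w $ K $ k * curv (higgs_grad x K) x (fst v))"
proof -
  have xp: "x \<in> patch M a" using p by (simp add: fst_chart_img x_def)
  note xb = patch_base[OF xp]
  define D where "D = frechet_derivative (lift L0 (\<lambda>_. 0) a) (at p)"
  have D: "D = (\<lambda>h. (fst h, - (conn_deriv a x (fst h) x + conn M a x (fst h))))"
    unfolding D_def x_def by (rule frechet_derivative_at[OF lift_L0_has_derivative[OF p], symmetric])
  \<comment> \<open>The connection term in the fibre component of \<open>D h\<close> cancels against
    the one in \<open>eta\<close>.\<close>
  have eD: "eta M a p (D h) = - conn_deriv a x (fst h) x" for h
    by (simp add: eta_def D x_def)
  have 1: "frechet_derivative (\<lambda>q. Omega M a k q v w) (at p) (lift L0 (\<lambda>_. 0) a p) =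
    - (\<Sum>I\<in>UNIV. \<Sum>J\<in>UNIV. higgs_deriv x x I J * cross3 (fst v $ I) (fst w $ J) $ k)
    - (\<Sum>K\<in>UNIV. fst v $ K $ k * conn_deriv a x x (fst w) $ K)
    + (\<Sum>K\<in>UNIV. fst w $ K $ k * conn_deriv a x x (fst v) $ K)"
  proof -
    define S where "S = (\<chi> I J. higgs_deriv x x I J)"
    have S: "S $ I $ J = higgs_deriv x x I J" for I J by (simp add: S_def)
    have "transpose S = S"
      by (simp add: transpose_def vec_eq_iff S higgs_deriv_sym[OF xb, of x])
    from sum_dx_wedge_dx[OF this]
    have "(\<Sum>I\<in>UNIV. \<Sum>J\<in>UNIV. higgs_deriv x x I J * dx_wedge_dx I J k (fst v) (fst w)) =
        2 * (\<Sum>I\<in>UNIV. \<Sum>J\<in>UNIV. higgs_deriv x x I J * cross3 (fst v $ I) (fst w $ J) $ k)"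
      unfolding S .
    then show ?thesis
      unfolding frechet_derivative_at[OF Omega_has_derivative[OF p], symmetric] fst_lift
      by (simp add: x_def[symmetric] L0_def sum_subtractf)
  qed
  \<comment> \<open>Exchanging the direction and the argument of \<open>conn_deriv\<close> costs a
    curvature term; the exchanged terms cancel against those from \<open>eD\<close>.\<close>
  have 2: "(\<Sum>K\<in>UNIV. u $ K $ k * conn_deriv a x x z $ K) =
      (\<Sum>K\<in>UNIV. conn_deriv a x z x $ K * u $ K $ k) + (\<Sum>K\<in>UNIV. u $ K $ k * curv (higgs_grad x K) x z)" for u z :: "'m base"
    unfolding conn_deriv_curv[OF xp, symmetric] by (simp add: algebra_simps sum_subtractf sum.distrib)
  have 3: "Omega M a k p (D v) w = Omega_form (higgs M x) (fst v) (- conn_deriv a x (fst v) x) (fst w) (eta M a p w) $ k"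
    "Omega M a k p v (D w) = Omega_form (higgs M x) (fst v) (eta M a p v) (fst w) (- conn_deriv a x (fst w) x) $ k"
    unfolding Omega_form_eq[OF p] eD by (simp_all add: D x_def)
  have 4: "Omega M a k p v w = Omega_form (higgs M x) (fst v) (eta M a p v) (fst w) (eta M a p w) $ k"
    unfolding Omega_form_eq[OF p] x_def ..
  show ?thesis
    unfolding lie_deriv_def 1 2 D_def[symmetric] 3 4 Omega_form_nth
    by (simp add: distrib_right sum.distrib sum_negf)
qed

text \<open>The Lie derivative also differentiates the field, so agreement at \<open>p\<close> alone
  would not do; the chart image is an open neighbourhood.\<close>

lemma lie_deriv_cong:
  assumes "p \<in> chart_img M a" "\<And>q. q \<in> chart_img M a \<Longrightarrow> X q = Y q"
    and "Y differentiable at p"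
  shows "lie_deriv X \<omega> p v w = lie_deriv Y \<omega> p v w"
proof -
  have "frechet_derivative Y (at p) = frechet_derivative X (at p)"
    by (rule frechet_derivative_transform_within_open[OF assms(3) open_chart_img assms(1)])
      (simp add: assms(2))
  then show ?thesis by (simp add: lie_deriv_def assms)
qed

section \<open>From a cone lift to the constraints\<close>

lemma Omega_rotation:
  assumes p: "p \<in> chart_img M a" and "fst Y0 = fst p" "fst Yi = L i (fst p)"
  shows "Omega M a j p Yi v - (\<Sum>k\<in>UNIV. eps i j k * Omega M a k p Y0 v) =
     - (if i = j then theta (higgs M (fst p)) (fst p) (fst v) else 0)
     + (\<Sum>K\<in>UNIV. (eta M a p Yi $ K + (\<Sum>I\<in>UNIV. higgs M (fst p) $ I $ K * fst p $ I $ i)) * fst v $ K $ j)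
     - (\<Sum>K\<in>UNIV. eta M a p Y0 $ K * (\<Sum>k\<in>UNIV. eps i j k * fst v $ K $ k))"
  unfolding Omega_form_eq[OF p] assms(2,3) by (rule Omega_form_rotation)

lemma cone_lift_rotation:
  assumes "cone_lift M X0 X V" and p: "p \<in> chart_img M a"
  shows "- (if i = j then theta (higgs M (fst p)) (fst p) (fst v) else 0)
     + (\<Sum>K\<in>UNIV. (eta M a p (X i a p) $ K + (\<Sum>I\<in>UNIV. higgs M (fst p) $ I $ K * fst p $ I $ i)) * fst v $ K $ j)
     - (\<Sum>K\<in>UNIV. eta M a p (X0 a p) $ K * (\<Sum>k\<in>UNIV. eps i j k * fst v $ K $ k))
     = - 1/2 * (if i = j then 1 else 0) * frechet_derivative (local_rep M a V) (at p) v"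
proof -
  have "fst (X0 a p) = fst p" "fst (X i a p) = L i (fst p)"
    using assms unfolding cone_lift_def projects_to_def L0_def by blast+
  from Omega_rotation[OF p this, of j v] show ?thesis
    using assms unfolding cone_lift_def by simp
qed

text \<open>For i = 1, j = 2 the \<open>theta\<close> and dV terms drop out. The vector e_3 in slot
  \<open>A\<close> has no second component, which removes the \<open>X i\<close> term too and leaves
  only \<open>eta\<close> of \<open>X0\<close>.\<close>

lemma cone_lift_eta_X0:
  assumes "cone_lift M X0 X V" and p: "p \<in> chart_img M a"
  shows "eta M a p (X0 a p) = 0"
proof -
  have sel': "(\<Sum>K\<in>UNIV. c K * (\<Sum>k\<in>UNIV. eps i j k * axis A \<alpha> $ K $ k)) =
      c A * (\<Sum>k\<in>UNIV. eps i j k * \<alpha> $ k)" for c :: "'m \<Rightarrow> real" and A \<alpha> i j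
    using sum_axis[of "\<lambda>K y. c K * (\<Sum>k\<in>UNIV. eps i j k * y $ k)" A \<alpha>] by simp
  have "eta M a p (X0 a p) $ A = 0" for A
    using cone_lift_rotation[OF assms, of 1 2 "(axis A (axis 3 1), 0)"]
    unfolding fst_conv sum_axis_nth sel' by (simp add: axis_def sum_3)
  then show ?thesis by (simp add: vec_eq_iff)
qed

text \<open>With \<open>eta\<close> of \<open>X0\<close> gone, the case i = 1, j = 2 on e_2
  annihilates the bracket containing \<open>eta\<close> of \<open>X 1\<close>. The diagonal case i =
  j = 1 then compares \<open>theta\<close> with dV alone.\<close>

lemma cone_lift_potential:
  assumes "cone_lift M X0 X V" and p: "p \<in> chart_img M a"
  shows "frechet_derivative (local_rep M a V) (at p) v = 2 * theta (higgs M (fst p)) (fst p) (fst v)"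
proof -
  have "eta M a p (X 1 a p) $ A + (\<Sum>I\<in>UNIV. higgs M (fst p) $ I $ A * fst p $ I $ 1) = 0" for A
    using cone_lift_rotation[OF assms, of 1 2 "(axis A (axis 2 1), 0)"]
    unfolding fst_conv sum_axis_nth cone_lift_eta_X0[OF assms] by simp
  with cone_lift_rotation[OF assms, of 1 1 v] cone_lift_eta_X0[OF assms]
  show ?thesis by simp
qed

lemma cone_lift_X0:
  assumes "cone_lift M X0 X V" and p: "p \<in> chart_img M a"
  shows "X0 a p = lift L0 (\<lambda>_. 0) a p"
proof (rule eq_by_eta)
  show "fst (X0 a p) = fst (lift L0 (\<lambda>_. 0) a p)"
    using assms unfolding cone_lift_def projects_to_def by simp
  show "eta M a p (X0 a p) = eta M a p (lift L0 (\<lambda>_. 0) a p)"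
    using cone_lift_eta_X0[OF assms] by simp
qed

text \<open>A cone lift forces \<open>X0\<close> to be the horizontal lift, so the extra terms in
  \<open>lie_deriv_lift_L0\<close> must vanish; coordinate vectors separate the two
  constraints.\<close>

lemma cone_lift_constraints:
  assumes "cone_lift M X0 X V" and "x \<in> base_set M"
  shows "higgs_rot x I J = 0" "higgs_deriv x x I J = - higgs M x $ I $ J"
proof -
  from assms(2) patches obtain a where x: "x \<in> patch M a" by blast
  \<comment> \<open>Any point of the fibre would serve, since the constraints live on the
    base.\<close>
  define p :: "'m pt" where "p = (x, 0)"
  have p: "p \<in> chart_img M a" "fst p = x" using x by (simp_all add: p_def fst_chart_img)
  have lie: "lie_deriv (lift L0 (\<lambda>_. 0) a) (Omega M a k) p v w = Omega M a k p v w" for k v w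
  proof -
    have "lie_deriv (X0 a) (Omega M a k) p v w = lie_deriv (lift L0 (\<lambda>_. 0) a) (Omega M a k) p v w"
      by (rule lie_deriv_cong[OF p(1)])
        (auto intro: cone_lift_X0[OF assms(1)] differentiableI[OF lift_L0_has_derivative[OF p(1)]])
    then show ?thesis using assms(1) p(1) unfolding cone_lift_def by simp
  qed
  have eq: "(\<Sum>I\<in>UNIV. \<Sum>J\<in>UNIV. (higgs_deriv x x I J + higgs M x $ I $ J) * cross3 (v $ I) (w $ J) $ k)
    + (\<Sum>K\<in>UNIV. v $ K $ k * (\<Sum>J\<in>UNIV. w $ J \<bullet> higgs_rot x K J))
    - (\<Sum>K\<in>UNIV. w $ K $ k * (\<Sum>J\<in>UNIV. v $ J \<bullet> higgs_rot x K J)) = 0" for v w k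
    using lie_deriv_lift_L0[OF p(1), of k "(v, 0)" "(w, 0)"]
    unfolding lie p(2) curv_euler[OF assms(2)] fst_conv by linarith
  have ax: "(higgs_deriv x x A B + higgs M x $ A $ B) * cross3 \<alpha> \<beta> $ k
     + \<alpha> $ k * (\<beta> \<bullet> higgs_rot x A B) - \<beta> $ k * (\<alpha> \<bullet> higgs_rot x B A) = 0" for A B \<alpha> \<beta> k
  proof -
    have 1: "(\<Sum>J\<in>UNIV. axis A \<alpha> $ J \<bullet> f J) = \<alpha> \<bullet> f A" for f and A :: 'm and \<alpha> :: "real^3"
      using sum_axis[of "\<lambda>J y. y \<bullet> f J" A \<alpha>] by simp
    have 2: "(\<Sum>K\<in>UNIV. axis A \<alpha> $ K $ k * f K) = \<alpha> $ k * f A" for f :: "'m \<Rightarrow> real" and A \<alpha>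
      using sum_axis[of "\<lambda>J y. y $ k * f J" A \<alpha>] by simp
    have 3: "(\<Sum>J\<in>UNIV. f J * cross3 y (axis B \<beta> $ J) $ k) = f B * cross3 y \<beta> $ k" for f :: "'m \<Rightarrow> real" and y
      using sum_axis[of "\<lambda>J z. f J * cross3 y z $ k" B \<beta>] by simp
    have 4: "(\<Sum>J\<in>UNIV. f J * cross3 (axis A \<alpha> $ J) y $ k) = f A * cross3 \<alpha> y $ k" for f :: "'m \<Rightarrow> real" and y
      using sum_axis[of "\<lambda>J z. f J * cross3 z y $ k" A \<alpha>] by simp
    show ?thesis
      using eq[of "axis A \<alpha>" "axis B \<beta>" k] unfolding 1 2 3 4 .
  qed
  have rot: "higgs_rot x A B = 0" for A B
  proof -
    have "higgs_rot x A B $ b = 0" for b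
    proof -
      \<comment> \<open>On e_c and e_b, component c: the cross product is orthogonal to e_c and e_b
        has no c-component, so only component b of \<open>higgs_rot\<close> survives.\<close>
      obtain c :: 3 where "c \<noteq> b" using ex_neq_3 by blast
      moreover have "cross3 (axis c 1) (axis b 1) $ c = 0"
        by (simp flip: dot_cross_self(1)[of "axis c 1" "axis b 1"] add: inner_axis')
      ultimately show ?thesis
        using ax[of A B "axis c 1" "axis b 1" c] by (simp add: inner_axis') (simp add: axis_def)
    qed
    then show ?thesis by (simp add: vec_eq_iff)
  qed
  then show "higgs_rot x I J = 0" .
  \<comment> \<open>With the rotational terms gone, e_1 x e_2 = e_3 isolates the remaining
    coefficient.\<close>
  show "higgs_deriv x x I J = - higgs M x $ I $ J"
    using ax[of I J "axis 1 1" "axis 2 1" 3] rot by (simp add: cross3_nth axis_def)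
qed

section \<open>The potential, its gradient and the lift it belongs to\<close>

definition potential :: "'n \<Rightarrow> real" where
  "potential u = 2 * theta (higgs M (proj M u)) (proj M u) (proj M u)"

lemma local_rep_potential:
  "p \<in> chart_img M a \<Longrightarrow> local_rep M a potential p = 2 * theta (higgs M (fst p)) (fst p) (fst p)"
  by (simp add: local_rep_def potential_def proj_chart_inv)

lemma smooth_higgs_nth: "smooth_on (base_set M) (\<lambda>x. higgs M x $ I $ J)"
  by (rule smooth_on_compose_linear[OF open_base bounded_linear_compose[OF bounded_linear_vec_nth
          bounded_linear_vec_nth] smooth_higgs])

lemma smooth_nth: "smooth_on (base_set M) (\<lambda>x. x $ I)"
  by (rule smooth_on_bounded_linear[OF open_base bounded_linear_vec_nth])

lemma smooth_potential: "smooth_fun M potential"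
  unfolding smooth_fun_def
proof
  fix a
  have "smooth_on (base_set M) (\<lambda>x. 2 * theta (higgs M x) x x)"
    unfolding theta_def
    by (intro smooth_on_bilinear[OF open_base bounded_bilinear_mult] smooth_on_const[OF open_base]
        smooth_on_sum[OF open_base] smooth_on_bilinear[OF open_base bounded_bilinear_inner]
        smooth_higgs_nth smooth_nth)
  from smooth_on_compose_fst[OF open_patch smooth_on_subset[OF this patch_subset], of a]
  have "smooth_on (chart_img M a) (\<lambda>p. 2 * theta (higgs M (fst p)) (fst p) (fst p))"
    by (simp add: chart_img_def)
  moreover have "smooth_on (chart_img M a) (local_rep M a potential) \<longleftrightarrow>
      smooth_on (chart_img M a) (\<lambda>p. 2 * theta (higgs M (fst p)) (fst p) (fst p))"
    by (rule smooth_on_cong[OF open_chart_img]) (rule local_rep_potential)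
  ultimately show "smooth_on (chart_img M a) (local_rep M a potential)" by blast
qed

definition cone_higgs :: bool where
  "cone_higgs \<longleftrightarrow> (\<forall>x\<in>base_set M. \<forall>I J. higgs_rot x I J = 0 \<and> higgs_deriv x x I J = - higgs M x $ I $ J)"

text \<open>Uses \<open>(t \<bullet> h) (x \<bullet> y) = (t \<bullet> y) (x \<bullet> h) + (t \<times> x) \<bullet> (h \<times> y)\<close>, where the last term sums to zero by
  rotation invariance.\<close>

lemma higgs_deriv_quadratic:
  assumes c: cone_higgs and x: "x \<in> base_set M"
  shows "(\<Sum>I\<in>UNIV. \<Sum>J\<in>UNIV. higgs_deriv x h I J * (x $ I \<bullet> x $ J)) = - theta (higgs M x) x h"
proof -
  let ?t = "higgs_grad x"
  note sym = higgs_grad_sym[OF x]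
  have sym3: "?t K I J = ?t J I K" for I J K
    by (rule trans[OF sym(1)[of K I J] trans[OF sym(2)[of K J I] sym(1)[of J K I]]])
  have "(\<Sum>I\<in>UNIV. \<Sum>J\<in>UNIV. higgs_deriv x h I J * (x $ I \<bullet> x $ J)) =
      (\<Sum>I\<in>UNIV. \<Sum>J\<in>UNIV. \<Sum>K\<in>UNIV. (?t K I J \<bullet> h $ K) * (x $ I \<bullet> x $ J))"
    by (simp only: higgs_deriv_def sum_distrib_right)
  also have "\<dots> = (\<Sum>I\<in>UNIV. \<Sum>K\<in>UNIV. \<Sum>J\<in>UNIV. (?t K I J \<bullet> h $ K) * (x $ I \<bullet> x $ J))"
    by (rule sum.cong[OF refl]) (rule sum.swap)
  also have "\<dots> = (\<Sum>K\<in>UNIV. \<Sum>I\<in>UNIV. \<Sum>J\<in>UNIV. (?t K I J \<bullet> h $ K) * (x $ I \<bullet> x $ J))"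
    by (rule sum.swap)
  also have "\<dots> = (\<Sum>K\<in>UNIV. \<Sum>I\<in>UNIV. \<Sum>J\<in>UNIV. (?t I K J \<bullet> x $ J) * (x $ I \<bullet> h $ K)
      + cross3 (?t I K J) (x $ I) \<bullet> cross3 (h $ K) (x $ J))"
  proof (intro sum.cong refl)
    fix I J K
    have "(t \<bullet> a) * (y \<bullet> z) = (t \<bullet> z) * (y \<bullet> a) + cross3 t y \<bullet> cross3 a z" for t a y z :: "real^3"
      by (simp add: inner_3 cross3_nth algebra_simps)
    then show "(?t K I J \<bullet> h $ K) * (x $ I \<bullet> x $ J) = (?t I K J \<bullet> x $ J) * (x $ I \<bullet> h $ K)
        + cross3 (?t I K J) (x $ I) \<bullet> cross3 (h $ K) (x $ J)"
      unfolding sym(2)[of K I J] .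
  qed
  also have "\<dots> = (\<Sum>K\<in>UNIV. \<Sum>I\<in>UNIV. \<Sum>J\<in>UNIV. (?t I K J \<bullet> x $ J) * (x $ I \<bullet> h $ K))
      + (\<Sum>K\<in>UNIV. \<Sum>I\<in>UNIV. \<Sum>J\<in>UNIV. cross3 (?t I K J) (x $ I) \<bullet> cross3 (h $ K) (x $ J))"
    by (simp only: sum.distrib)
  also have "(\<Sum>K\<in>UNIV. \<Sum>I\<in>UNIV. \<Sum>J\<in>UNIV. cross3 (?t I K J) (x $ I) \<bullet> cross3 (h $ K) (x $ J)) = 0"
  proof -
    have "(\<Sum>I\<in>UNIV. \<Sum>J\<in>UNIV. cross3 (?t I K J) (x $ I) \<bullet> cross3 (h $ K) (x $ J)) = 0" for K
    proof -
      have "(\<Sum>I\<in>UNIV. \<Sum>J\<in>UNIV. cross3 (?t I K J) (x $ I) \<bullet> cross3 (h $ K) (x $ J)) =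
        (\<Sum>J\<in>UNIV. \<Sum>I\<in>UNIV. cross3 (?t I K J) (x $ I) \<bullet> cross3 (h $ K) (x $ J))"
        by (rule sum.swap)
      also have "\<dots> = (\<Sum>J\<in>UNIV. higgs_rot x K J \<bullet> cross3 (h $ K) (x $ J))"
        by (simp only: higgs_rot_def inner_sum_left)
      also have "\<dots> = 0" using c x unfolding cone_higgs_def by simp
      finally show ?thesis .
    qed
    then show ?thesis by simp
  qed
  also have "(\<Sum>K\<in>UNIV. \<Sum>I\<in>UNIV. \<Sum>J\<in>UNIV. (?t I K J \<bullet> x $ J) * (x $ I \<bullet> h $ K)) =
      (\<Sum>K\<in>UNIV. \<Sum>I\<in>UNIV. higgs_deriv x x I K * (x $ I \<bullet> h $ K))"
  proof (intro sum.cong refl)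
    fix K I
    have "?t I K J = ?t J I K" for J by (rule trans[OF sym(2)[of I K J] sym3])
    then show "(\<Sum>J\<in>UNIV. (?t I K J \<bullet> x $ J) * (x $ I \<bullet> h $ K)) = higgs_deriv x x I K * (x $ I \<bullet> h $ K)"
      by (simp add: higgs_deriv_def sum_distrib_right)
  qed
  also have "\<dots> = (\<Sum>I\<in>UNIV. \<Sum>K\<in>UNIV. higgs_deriv x x I K * (x $ I \<bullet> h $ K))"
    by (rule sum.swap)
  also have "\<dots> = - theta (higgs M x) x h"
    using c x unfolding cone_higgs_def theta_def by (simp add: sum_negf)
  finally show ?thesis by simp
qed

text \<open>Differentiating the two position factors gives \<open>theta\<close> twice. By
  \<open>higgs_deriv_quadratic\<close> differentiating the Higgs field gives it once with a minus
  sign, so one copy remains.\<close>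

lemma local_rep_potential_has_derivative:
  assumes c: cone_higgs and p: "p \<in> chart_img M a"
  shows "(local_rep M a potential has_derivative (\<lambda>h. 2 * theta (higgs M (fst p)) (fst p) (fst h))) (at p)"
proof -
  define x where "x = fst p"
  have x: "x \<in> base_set M" using p by (auto simp: x_def fst_chart_img intro: patch_base)
  have N: "((\<lambda>y. y $ I) has_derivative (\<lambda>h. h $ I)) (at x)" for I
    by (rule bounded_linear_imp_has_derivative[OF bounded_linear_vec_nth])
  have "((\<lambda>y. 2 * theta (higgs M y) y y) has_derivative
     (\<lambda>h. 2 * (\<Sum>I\<in>UNIV. \<Sum>J\<in>UNIV. higgs M x $ I $ J * (x $ I \<bullet> h $ J + h $ I \<bullet> x $ J)
        + higgs_deriv x h I J * (x $ I \<bullet> x $ J)))) (at x)"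
    unfolding theta_def
    by (intro has_derivative_mult_right has_derivative_sum has_derivative_mult
        has_derivative_inner has_derivative_higgs_deriv[OF x] N)
  moreover have "2 * (\<Sum>I\<in>UNIV. \<Sum>J\<in>UNIV. higgs M x $ I $ J * (x $ I \<bullet> h $ J + h $ I \<bullet> x $ J)
        + higgs_deriv x h I J * (x $ I \<bullet> x $ J)) = 2 * theta (higgs M x) x h" for h
  proof -
    have "(\<Sum>I\<in>UNIV. \<Sum>J\<in>UNIV. higgs M x $ I $ J * (h $ I \<bullet> x $ J)) = theta (higgs M x) x h"
      using sum_sum_symmetric[OF higgs_transpose[OF x], of "\<lambda>I J. x $ I \<bullet> h $ J"]
      by (simp add: theta_def inner_commute)
    then show ?thesis
      unfolding distrib_left sum.distrib higgs_deriv_quadratic[OF c x] by (simp add: theta_def)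
  qed
  ultimately have "((\<lambda>y. 2 * theta (higgs M y) y y) has_derivative (\<lambda>h. 2 * theta (higgs M x) x h)) (at x)"
    by simp
  from has_derivative_compose[OF bounded_linear_imp_has_derivative[OF bounded_linear_fst] this[unfolded x_def]]
  have "((\<lambda>q. 2 * theta (higgs M (fst q)) (fst q) (fst q)) has_derivative
      (\<lambda>h. 2 * theta (higgs M (fst p)) (fst p) (fst h))) (at p)" .
  then show ?thesis
    by (rule has_derivative_transform_within_open[OF _ open_chart_img p]) (rule local_rep_potential[symmetric])
qed

lemma frechet_potential:
  "cone_higgs \<Longrightarrow> p \<in> chart_img M a \<Longrightarrow>
    frechet_derivative (local_rep M a potential) (at p) v = 2 * theta (higgs M (fst p)) (fst p) (fst v)"
  by (rule fun_cong[OF frechet_derivative_at[OF local_rep_potential_has_derivative, symmetric]])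

text \<open>The fibre parts are those forced by \<open>Omega_rotation\<close>: \<open>eta\<close> of
  \<open>X0\<close> is zero and \<open>eta\<close> of \<open>X i\<close> cancels the bracket there.
  What remains is \<open>theta\<close>, half the differential of the potential.\<close>

lemma cone_lift_exists:
  assumes c: cone_higgs
  shows "cone_lift M (lift L0 (\<lambda>_. 0))
    (\<lambda>i. lift (L i) (\<lambda>x. \<chi> K. - (\<Sum>I\<in>UNIV. higgs M x $ I $ K * x $ I $ i))) potential"
    (is "cone_lift M ?E ?R potential")
  unfolding cone_lift_def
proof (intro conjI allI ballI)
  have nth2: "smooth_on (base_set M) (\<lambda>x. x $ I $ j)" for I j
    by (rule smooth_on_compose_linear[OF open_base bounded_linear_vec_nth smooth_nth])
  have "smooth_on (base_set M) L0"
    unfolding L0_def[abs_def] by (rule smooth_on_bounded_linear[OF open_base bounded_linear_ident])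
  then show "vector_field M ?E"
    by (rule vector_field_lift) (rule smooth_on_const[OF open_base])
  show "projects_to M ?E L0" "projects_to M (?R i) (L i)" for i
    by (simp_all add: projects_to_def)
  show "vector_field M (?R i)" for i
  proof (rule vector_field_lift)
    have "linear (L i :: 'm base \<Rightarrow> _)"
      by (rule linearI) (simp_all add: vec_eq_iff L_nth forall_3 cross3_nth algebra_simps)
    then show "smooth_on (base_set M) (L i)"
      by (intro smooth_on_bounded_linear[OF open_base]) (simp add: linear_conv_bounded_linear)
    show "smooth_on (base_set M) (\<lambda>x. \<chi> K. - (\<Sum>I\<in>UNIV. higgs M x $ I $ K * x $ I $ i))"
      by (intro smooth_on_vec_lambda smooth_on_minus smooth_on_sum open_base
          smooth_on_bilinear[OF _ bounded_bilinear_mult] smooth_higgs_nth nth2)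
  qed
  show "smooth_fun M potential" by (rule smooth_potential)
next
  fix a p i j v assume p: "p \<in> chart_img M a"
  have "fst (?E a p) = fst p" by (simp add: L0_def)
  from Omega_rotation[OF p this, of "?R i a p" i j v]
  show "Omega M a j p (?R i a p) v = (\<Sum>k\<in>UNIV. eps i j k * Omega M a k p (?E a p) v)
        - 1/2 * (if i = j then 1 else 0) * frechet_derivative (local_rep M a potential) (at p) v"
    by (cases "i = j") (simp_all add: frechet_potential[OF c p] diff_eq_eq)
next
  fix a p k v w assume p: "p \<in> chart_img M a"
  have "fst p \<in> base_set M" using p by (auto simp: fst_chart_img intro: patch_base)
  with c show "lie_deriv (?E a) (Omega M a k) p v w = Omega M a k p v w"
    unfolding lie_deriv_lift_L0[OF p] cone_higgs_def by (simp add: curv_euler)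
qed

section \<open>Complex structures and the Kaehler potential property\<close>

text \<open>The endomorphism \<open>I\<^sub>i\<close> solving \<open>\<Omega>\<^sub>i(v, w) = G(v, I\<^sub>i w)\<close>.\<close>

definition cplx :: "'c \<Rightarrow> 3 \<Rightarrow> 'm pt \<Rightarrow> 'm pt \<Rightarrow> 'm pt" where
  "cplx a i p w =
    (let y = (\<chi> J. - cross3 (fst w $ J) (axis i 1)
                - (matrix_inv (higgs M (fst p)) *v eta M a p w) $ J *\<^sub>R axis i 1)
     in (y, higgs M (fst p) *v (\<chi> J. fst w $ J $ i) - conn M a (fst p) y))"

lemma fst_cplx: "fst (cplx a i p w) $ J = - cross3 (fst w $ J) (axis i 1)
      - (matrix_inv (higgs M (fst p)) *v eta M a p w) $ J *\<^sub>R axis i 1"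
  and eta_cplx: "eta M a p (cplx a i p w) = higgs M (fst p) *v (\<chi> J. fst w $ J $ i)"
  by (simp_all add: cplx_def Let_def eta_def)

text \<open>The term with \<open>matrix_inv\<close> in \<open>cplx\<close> turns into the connection
  term, since \<open>theta\<close> multiplies by the Higgs field. At v = x this says dU o I_i = 2
  iota_X0 Omega_i.\<close>

lemma theta_cplx:
  assumes p: "p \<in> chart_img M a"
  shows "theta (higgs M (fst p)) v (fst (cplx a i p w)) = Omega_form (higgs M (fst p)) v 0 (fst w) (eta M a p w) $ i"
proof -
  let ?U = "higgs M (fst p)" and ?\<eta> = "eta M a p w"
  let ?z = "matrix_inv ?U *v ?\<eta>"
  have x: "fst p \<in> base_set M" using p by (auto simp: fst_chart_img intro: patch_base)
  have 1: "y \<bullet> cross3 u (axis i 1) = cross3 y u $ i" for y u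
    using exhaust_3[of i] by (auto simp: inner_3 cross3_nth axis_def)
  have 2: "y \<bullet> (- cross3 u (axis i 1) - r *\<^sub>R axis i 1) = - (cross3 y u $ i) - r * y $ i" for y u r
    by (simp add: inner_diff_right 1 inner_axis)
  have "theta ?U v (fst (cplx a i p w)) =
      (\<Sum>I\<in>UNIV. \<Sum>J\<in>UNIV. - (?U $ I $ J * cross3 (v $ I) (fst w $ J) $ i) - ?U $ I $ J * ?z $ J * v $ I $ i)"
    unfolding theta_def fst_cplx 2 by (simp add: algebra_simps)
  also have "\<dots> = - (\<Sum>I\<in>UNIV. \<Sum>J\<in>UNIV. ?U $ I $ J * cross3 (v $ I) (fst w $ J) $ i)
      - (\<Sum>I\<in>UNIV. (?U *v ?z) $ I * v $ I $ i)"
    by (simp add: sum_subtractf sum_negf matrix_vector_mult_def sum_distrib_right)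
  finally show ?thesis
    by (simp add: Omega_form_nth matrix_inv_vector(2)[OF higgs_det[OF x]])
qed

text \<open>The base part of the metric is \<open>theta_cplx\<close>, which lacks the summand with
  \<open>eta\<close> of \<open>v\<close>; the fibre part supplies it because the Higgs field cancels
  its inverse.\<close>

lemma metric_cplx:
  assumes p: "p \<in> chart_img M a"
  shows "metric M a p v (cplx a i p w) = Omega M a i p v w"
proof -
  let ?U = "higgs M (fst p)"
  have x: "fst p \<in> base_set M" using p by (auto simp: fst_chart_img intro: patch_base)
  have "(\<Sum>I\<in>UNIV. \<Sum>J\<in>UNIV. matrix_inv ?U $ I $ J * (eta M a p v $ I * eta M a p (cplx a i p w) $ J)) =
      (\<Sum>I\<in>UNIV. eta M a p v $ I * (matrix_inv ?U *v eta M a p (cplx a i p w)) $ I)"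
    by (simp add: matrix_vector_mult_def sum_distrib_left algebra_simps)
  also have "\<dots> = (\<Sum>I\<in>UNIV. eta M a p v $ I * fst w $ I $ i)"
    unfolding eta_cplx matrix_inv_vector(1)[OF higgs_det[OF x]] by simp
  finally show ?thesis
    using theta_cplx[OF p, of "fst v" i w]
    unfolding metric_def Omega_form_eq[OF p] by (simp add: theta_def Omega_form_nth)
qed

lemma contraction_has_derivative:
  assumes p: "p \<in> chart_img M a"
  defines "x \<equiv> fst p"
  shows "((\<lambda>q. Omega_form (higgs M (fst q)) (fst q) 0 (fst w) (eta M a q w) $ i) has_derivative
    (\<lambda>h. - (\<Sum>I\<in>UNIV. \<Sum>J\<in>UNIV. higgs_deriv x (fst h) I J * cross3 (x $ I) (fst w $ J) $ i)
         - (\<Sum>I\<in>UNIV. \<Sum>J\<in>UNIV. higgs M x $ I $ J * cross3 (fst h $ I) (fst w $ J) $ i)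
         - (\<Sum>K\<in>UNIV. eta M a p w $ K * fst h $ K $ i)
         - (\<Sum>K\<in>UNIV. conn_deriv a x (fst h) (fst w) $ K * x $ K $ i))) (at p)"
proof -
  have xp: "x \<in> patch M a" using p by (simp add: fst_chart_img x_def)
  have F: "((\<lambda>q. fst q) has_derivative (\<lambda>h. fst h)) (at p)"
    by (rule bounded_linear_imp_has_derivative[OF bounded_linear_fst])
  have U: "((\<lambda>q. higgs M (fst q) $ I $ J) has_derivative (\<lambda>h. higgs_deriv x (fst h) I J)) (at p)" for I J
    using has_derivative_compose[OF F has_derivative_higgs_deriv[OF patch_base[OF xp, unfolded x_def]]]
    unfolding x_def .
  have "((\<lambda>q. snd w + conn M a (fst q) (fst w)) has_derivative (\<lambda>h. 0 + conn_deriv a x (fst h) (fst w))) (at p)"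
    unfolding x_def by (intro has_derivative_add has_derivative_const
        has_derivative_compose[OF F conn_has_derivative[OF xp[unfolded x_def]]])
  from bounded_linear.has_derivative[OF bounded_linear_vec_nth this]
  have E: "((\<lambda>q. eta M a q w $ K) has_derivative (\<lambda>h. conn_deriv a x (fst h) (fst w) $ K)) (at p)" for K
    by (simp add: eta_def)
  have N: "((\<lambda>q. fst q $ K $ i) has_derivative (\<lambda>h. fst h $ K $ i)) (at p)" for K
    by (rule bounded_linear.has_derivative[OF bounded_linear_vec_nth
          bounded_linear.has_derivative[OF bounded_linear_vec_nth F]])
  have "linear (\<lambda>y. cross3 y u $ i)" for u
    using exhaust_3[of i] by (intro linearI) (auto simp: cross3_nth algebra_simps)
  then have "bounded_linear (\<lambda>y. cross3 y u $ i)" for u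
    by (simp add: linear_conv_bounded_linear)
  from bounded_linear.has_derivative[OF this bounded_linear.has_derivative[OF bounded_linear_vec_nth F]]
  have C: "((\<lambda>q. cross3 (fst q $ I) u $ i) has_derivative (\<lambda>h. cross3 (fst h $ I) u $ i)) (at p)" for I u .
  have "((\<lambda>q. - (\<Sum>I\<in>UNIV. \<Sum>J\<in>UNIV. higgs M (fst q) $ I $ J * cross3 (fst q $ I) (fst w $ J) $ i)
      - (\<Sum>K\<in>UNIV. eta M a q w $ K * fst q $ K $ i)) has_derivative
    (\<lambda>h. - (\<Sum>I\<in>UNIV. \<Sum>J\<in>UNIV. higgs M (fst p) $ I $ J * cross3 (fst h $ I) (fst w $ J) $ i
        + higgs_deriv x (fst h) I J * cross3 (fst p $ I) (fst w $ J) $ i)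
      - (\<Sum>K\<in>UNIV. eta M a p w $ K * fst h $ K $ i + conn_deriv a x (fst h) (fst w) $ K * fst p $ K $ i))) (at p)"
    by (intro has_derivative_diff has_derivative_minus has_derivative_sum has_derivative_mult U E N C)
  then show ?thesis
    unfolding Omega_form_nth x_def[symmetric] by (simp add: sum.distrib diff_diff_eq algebra_simps)
qed

lemma hyperkaehler_potential_potential:
  assumes c: cone_higgs
  shows "hyperkaehler_potential M potential"
  unfolding hyperkaehler_potential_def
proof (intro conjI allI exI ballI smooth_potential)
  fix a p i v w assume p: "p \<in> chart_img M a"
  show "Omega M a i p v w = metric M a p v (cplx a i p w)" by (simp add: metric_cplx[OF p])
  define x where "x = fst p"
  have xp: "x \<in> patch M a" using p by (simp add: fst_chart_img x_def)
  note xb = patch_base[OF xp]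
  let ?f = "\<lambda>q z. Omega_form (higgs M (fst q)) (fst q) 0 (fst z) (eta M a q z) $ i"
  let ?D = "\<lambda>h z. - (\<Sum>I\<in>UNIV. \<Sum>J\<in>UNIV. higgs_deriv x (fst h) I J * cross3 (x $ I) (fst z $ J) $ i)
         - (\<Sum>I\<in>UNIV. \<Sum>J\<in>UNIV. higgs M x $ I $ J * cross3 (fst h $ I) (fst z $ J) $ i)
         - (\<Sum>K\<in>UNIV. eta M a p z $ K * fst h $ K $ i)
         - (\<Sum>K\<in>UNIV. conn_deriv a x (fst h) (fst z) $ K * x $ K $ i)"
  \<comment> \<open>The gradient formula and \<open>theta_cplx\<close> hold on the whole open chart
    image, so the contracted form may be differentiated in place of dU o I_i.\<close>
  have "((\<lambda>q. frechet_derivative (local_rep M a potential) (at q) (cplx a i q z)) has_derivative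
      (\<lambda>h. 2 * ?D h z)) (at p)" for z
  proof (rule has_derivative_transform_within_open[OF _ open_chart_img p])
    show "((\<lambda>q. 2 * ?f q z) has_derivative (\<lambda>h. 2 * ?D h z)) (at p)"
      unfolding x_def by (intro has_derivative_mult_right contraction_has_derivative[OF p])
    show "2 * ?f q z = frechet_derivative (local_rep M a potential) (at q) (cplx a i q z)"
      if "q \<in> chart_img M a" for q
      unfolding frechet_potential[OF c that] theta_cplx[OF that] ..
  qed
  note fd = fun_cong[OF frechet_derivative_at[OF this, symmetric]]
  have half: "1/2 * (2 * r - 2 * s) = r - s" for r s :: real by simp
  have ext: "1/2 * ext_deriv (\<lambda>q z. frechet_derivative (local_rep M a potential) (at q) (cplx a i q z)) p v w
      = ?D v w - ?D w v"
    unfolding ext_deriv_def fd by (rule half)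
  have "(\<Sum>I\<in>UNIV. \<Sum>J\<in>UNIV. (\<Sum>K\<in>UNIV. higgs_grad x K I J \<bullet> fst v $ K) *\<^sub>R cross3 (x $ I) (fst w $ J))
    - (\<Sum>I\<in>UNIV. \<Sum>J\<in>UNIV. (\<Sum>K\<in>UNIV. higgs_grad x K I J \<bullet> fst w $ K) *\<^sub>R cross3 (x $ I) (fst v $ J))
    + (\<Sum>K\<in>UNIV. curv (higgs_grad x K) (fst v) (fst w) *\<^sub>R x $ K)
    = (\<Sum>I\<in>UNIV. \<Sum>J\<in>UNIV. (\<Sum>K\<in>UNIV. higgs_grad x K I J \<bullet> x $ K) *\<^sub>R cross3 (fst v $ I) (fst w $ J))"
    by (rule closedness_identity[OF higgs_grad_sym(2)[OF xb] higgs_grad_sym(1)[OF xb]])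
      (use c xb in \<open>simp add: cone_higgs_def higgs_rot_def\<close>)
  from arg_cong[OF this, of "\<lambda>y. y $ i"]
  have closed: "(\<Sum>I\<in>UNIV. \<Sum>J\<in>UNIV. higgs_deriv x (fst v) I J * cross3 (x $ I) (fst w $ J) $ i)
    - (\<Sum>I\<in>UNIV. \<Sum>J\<in>UNIV. higgs_deriv x (fst w) I J * cross3 (x $ I) (fst v $ J) $ i)
    + (\<Sum>K\<in>UNIV. curv (higgs_grad x K) (fst v) (fst w) * x $ K $ i)
    = - (\<Sum>I\<in>UNIV. \<Sum>J\<in>UNIV. higgs M x $ I $ J * cross3 (fst v $ I) (fst w $ J) $ i)"
    using c xb unfolding cone_higgs_def higgs_deriv_def[symmetric] by (simp add: sum_negf)
  \<comment> \<open>Antisymmetrizing \<open>?D\<close> produces the Higgs term of Omega twice;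
    \<open>closed\<close> takes one copy back.\<close>
  have skew: "(\<Sum>I\<in>UNIV. \<Sum>J\<in>UNIV. higgs M x $ I $ J * cross3 (fst w $ I) (fst v $ J) $ i) =
      - (\<Sum>I\<in>UNIV. \<Sum>J\<in>UNIV. higgs M x $ I $ J * cross3 (fst v $ I) (fst w $ J) $ i)"
  proof -
    have "cross3 (fst w $ I) (fst v $ J) $ i = - (cross3 (fst v $ J) (fst w $ I) $ i)" for I J
      by (subst cross_skew) simp
    then show ?thesis
      using sum_sum_symmetric[OF higgs_transpose[OF xb], of "\<lambda>I J. - (cross3 (fst v $ I) (fst w $ J) $ i)"]
      by (simp add: sum_negf)
  qed
  have cv: "(\<Sum>K\<in>UNIV. curv (higgs_grad x K) (fst v) (fst w) * x $ K $ i) =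
      (\<Sum>K\<in>UNIV. conn_deriv a x (fst v) (fst w) $ K * x $ K $ i)
      - (\<Sum>K\<in>UNIV. conn_deriv a x (fst w) (fst v) $ K * x $ K $ i)"
    unfolding conn_deriv_curv[OF xp, symmetric] by (simp add: left_diff_distrib sum_subtractf)
  have om: "Omega M a i p v w =
     - (\<Sum>I\<in>UNIV. \<Sum>J\<in>UNIV. higgs M x $ I $ J * cross3 (fst v $ I) (fst w $ J) $ i)
     - (\<Sum>K\<in>UNIV. eta M a p w $ K * fst v $ K $ i) + (\<Sum>K\<in>UNIV. eta M a p v $ K * fst w $ K $ i)"
    unfolding Omega_form_eq[OF p] Omega_form_nth x_def ..
  show "Omega M a i p v w =
      1/2 * ext_deriv (\<lambda>q z. frechet_derivative (local_rep M a potential) (at q) (cplx a i q z)) p v w"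
    unfolding ext om using closed skew cv by linarith
qed

section \<open>Uniqueness of the potential, and the equivalence\<close>

text \<open>By \<open>cone_lift_potential\<close> every potential has the same differential. The
  difference is constant on a ball in a chart, hence near each point of the total space, hence on
  components.\<close>

lemma potential_unique:
  assumes "cone_lift M X0 X V" and c: cone_higgs and C: "C \<in> components (total_space M)"
  shows "\<exists>c. \<forall>u\<in>C. V u = potential u + c"
proof -
  have "\<exists>c. \<forall>u\<in>C. V u - potential u = c"
  proof (rule locally_constant_on_component[OF C])
    fix u assume u: "u \<in> total_space M"
    have "proj M u \<in> base_set M"
      using u proj_image by blast
    then obtain a where a: "proj M u \<in> patch M a" using patches by blast
    then have uo: "u \<in> over M a" using u by (simp add: over_def)
    let ?f = "\<lambda>p. local_rep M a V p - local_rep M a potential p"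
    have D: "(?f has_derivative (\<lambda>h. 0)) (at p)" if p: "p \<in> chart_img M a" for p
    proof -
      have "smooth_on (chart_img M a) (local_rep M a V)"
        using assms(1) unfolding cone_lift_def smooth_fun_def by blast
      from smooth_on_has_derivative[OF this p]
      have "(local_rep M a V has_derivative (\<lambda>h. 2 * theta (higgs M (fst p)) (fst p) (fst h))) (at p)"
        unfolding cone_lift_potential[OF assms(1) p, abs_def] .
      from has_derivative_diff[OF this local_rep_potential_has_derivative[OF c p]] show ?thesis by simp
    qed
    have cu: "chart M a u \<in> chart_img M a"
      using a by (simp add: fst_chart_img chart_def)
    then obtain e where e: "e > 0" "ball (chart M a u) e \<subseteq> chart_img M a"
      using open_chart_img open_contains_ball by blast
    have const: "?f q = ?f (chart M a u)" if "q \<in> ball (chart M a u) e" for q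
    proof (rule has_derivative_zero_unique[OF convex_ball _ that])
      show "chart M a u \<in> ball (chart M a u) e" using e by simp
      show "(?f has_derivative (\<lambda>h. 0)) (at p within ball (chart M a u) e)" if "p \<in> ball (chart M a u) e" for p
        using D[of p] that e(2) has_derivative_at_withinI by blast
    qed
    have "continuous_on (over M a) (chart M a)"
      using homeo by (rule homeomorphism_cont1)
    from continuous_on_open_invariant[THEN iffD1, OF this, rule_format, OF open_ball[of "chart M a u" e]]
    \<comment> \<open>\<open>A\<close> cuts out the preimage of the ball inside
      \<open>over M a\<close>, and \<open>B\<close> below cuts out \<open>over M a\<close> inside
      the total space; their intersection is the required neighbourhood.\<close>
    obtain A where A: "open A" "A \<inter> over M a = chart M a -` ball (chart M a u) e \<inter> over M a"
      by blast
    from continuous_on_open_invariant[THEN iffD1, OF cont_proj, rule_format, OF open_patch]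
    obtain B where B: "open B" "B \<inter> total_space M = proj M -` patch M a \<inter> total_space M"
      by blast
    have f: "V w - potential w = ?f (chart M a w)" if "w \<in> over M a" for w
      by (simp add: local_rep_def chart_inv_chart[OF that])
    show "\<exists>T. open T \<and> u \<in> T \<and> (\<forall>w\<in>total_space M \<inter> T. V w - potential w = V u - potential u)"
    proof (intro exI conjI ballI)
      show "open (A \<inter> B)" using A B by blast
      show "u \<in> A \<inter> B"
      proof -
        have "u \<in> A \<inter> over M a" unfolding A(2) using uo e(1) by simp
        moreover have "u \<in> B \<inter> total_space M" unfolding B(2) using u a by simp
        ultimately show ?thesis by blast
      qed
      fix w assume w: "w \<in> total_space M \<inter> (A \<inter> B)"
      then have "w \<in> proj M -` patch M a \<inter> total_space M" using B(2) by blast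
      then have wo: "w \<in> over M a" by (simp add: over_def)
      then have "w \<in> chart M a -` ball (chart M a u) e \<inter> over M a" using A(2) w by blast
      then have "chart M a w \<in> ball (chart M a u) e" by blast
      from const[OF this] show "V w - potential w = V u - potential u"
        unfolding f[OF wo] f[OF uo] .
    qed
  qed
  then obtain c where "\<forall>u\<in>C. V u - potential u = c" by blast
  then have "\<forall>u\<in>C. V u = potential u + c" by (auto simp: algebra_simps)
  then show ?thesis by blast
qed

lemma cone_higgs_iff:
  "cone_higgs \<longleftrightarrow> (\<forall>I J. \<forall>x\<in>base_set M.
    (\<forall>i. dir_deriv (L i) (\<lambda>y. higgs M y $ I $ J) x = 0) \<and>
    dir_deriv L0 (\<lambda>y. higgs M y $ I $ J) x = - (higgs M x $ I $ J))"
proof -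
  have r: "(\<forall>i. dir_deriv (L i) (\<lambda>y. higgs M y $ I $ J) x = 0) \<longleftrightarrow> higgs_rot x I J = 0"
    and d: "dir_deriv L0 (\<lambda>y. higgs M y $ I $ J) x = higgs_deriv x x I J" if "x \<in> base_set M" for x I J
    by (simp_all add: dir_deriv_higgs[OF that] higgs_deriv_L vec_eq_iff L0_def)
  then show ?thesis unfolding cone_higgs_def by (auto simp: r d)
qed

end

text \<open>The cone equations see only the differential of the potential, and the total space may
  be disconnected; hence uniqueness up to one constant per component.\<close>

theorem proposition14:
  fixes M :: "('n::topological_space, 'c, 'm::finite) gh_data"
    and U :: "'n \<Rightarrow> real"
  assumes "extended_gibbons_hawking M"
    and "U = (\<lambda>u. 2 * (\<Sum>I\<in>UNIV. \<Sum>J\<in>UNIV.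
                 higgs M (proj M u) $ I $ J * (proj M u $ I \<bullet> proj M u $ J)))"
  shows "((\<exists>X0 X V. cone_lift M X0 X V) \<longleftrightarrow>
           (\<forall>I J. \<forall>x\<in>base_set M.
              (\<forall>i. dir_deriv (L i) (\<lambda>y. higgs M y $ I $ J) x = 0) \<and>
              dir_deriv L0 (\<lambda>y. higgs M y $ I $ J) x = - (higgs M x $ I $ J))) \<and>
         ((\<exists>X0 X V. cone_lift M X0 X V) \<longrightarrow>
           (\<exists>X0 X. cone_lift M X0 X U) \<and> hyperkaehler_potential M U \<and>
           (\<forall>X0 X V. cone_lift M X0 X V \<longrightarrow>
              (\<forall>C\<in>components (total_space M). \<exists>c. \<forall>u\<in>C. V u = U u + c)))"
proof -
  interpret extended_gh M by unfold_locales (rule assms(1))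
  have U: "U = potential"
    unfolding assms(2) potential_def[abs_def] theta_def ..
  have "cone_higgs" if "cone_lift M X0 X V" for X0 X V
    unfolding cone_higgs_def using cone_lift_constraints[OF that] by blast
  then show ?thesis
    unfolding U cone_higgs_iff[symmetric]
    using cone_lift_exists hyperkaehler_potential_potential potential_unique by blast
qed

end
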